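(* Let $n$ be a positive integer and let $\{y_I\}$ be a collection of nonnegative real numbers indexed by the nonempty subsets $I\subseteq[n]$. Then $$\mathrm{Vol}\,P_n^y(\{y_I\})=\frac{1}{(n-1)!}\sum_{J_1,\dots,J_{n-1}\subseteq[n]}(-1)^{|I(J_1,\dots,J_{n-1})|}\sum_{w}y_{w(J_1)}\cdots y_{w(J_{n-1})},$$ where the first sum is over ordered collections of nonempty subsets $J_1,\dots,J_{n-1}$ of $[n]$, and the second sum is over permutations $w\in S_n$ with descent set $I(w)=I(J_1,\dots,J_{n-1})$.
   Context: $[n]=\{1,\dots,n\}$, $S_n$ is the symmetric group, $w(J)=\{w(j)\mid j\in J\}$. For nonempty $I\subseteq[n]$, $\Delta_I=\mathrm{ConvexHull}(e_i\mid i\in I)\subset\mathbb{R}^n$, with $e_i$ the coordinate vectors. The generalized permutohedron is the Minkowski sum $P_n^y(\{y_I\})=\sum_{\emptyset\neq I\subseteq[n]}y_I\,\Delta_I$; it lies in a hyperplane $t_1+\cdots+t_n=c$. $\mathrm{Vol}$ denotes the usual $(n-1)$-dimensional volume of the image under the projection $(t_1,\dots,t_n)\mapsto(t_1,\dots,t_{n-1})$ (for $n=1$ the volume of a point is $1$). The descent set of $w\in S_n$ is $I(w)=\{i\in\{1,\dots,n-1\}\mid w(i)>w(i+1)\}$. Given nonnegative integers $c_1,\dots,c_n$ with $c_1+\cdots+c_n=n-1$, form $(\epsilon_1,\dots,\epsilon_{2n-2})\in\{1,-1\}^{2n-2}$ by replacing each entry $c_i$ ($i=1,\dots,n$, in order)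 by $c_i$ copies of $1$ followed by a single $-1$, and then removing the last $-1$; define $I_{c_1,\dots,c_n}=\{i\in\{1,\dots,n-1\}\mid\epsilon_1+\cdots+\epsilon_{2i-1}<0\}$. For nonempty subsets $J_1,\dots,J_{n-1}\subseteq[n]$, let $(a_1,\dots,a_n)=e_{\min(J_1)}+\cdots+e_{\min(J_{n-1})}$ and $I(J_1,\dots,J_{n-1})=I_{a_1,\dots,a_n}$. *)

theory Defs
  imports "HOL-Analysis.Analysis" "HOL-Analysis.Finite_Function_Topology"
    "HOL-Combinatorics.Permutations"
begin

text \<open>
  Since \<open>n\<close> is a term-level parameter, points of \<open>\<real>\<^sup>n\<close> are finitely supported functions on
  \<open>nat\<close> whose coordinates outside \<open>{1..n}\<close> vanish, with \<open>Poly_Mapping.single i 1\<close> as the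
  coordinate vector \<open>e\<^sub>i\<close>.
\<close>

definition coord_simplex :: "nat set \<Rightarrow> (nat, real) poly_mapping set" where
  "coord_simplex I = convex hull ((\<lambda>i. Poly_Mapping.single i 1) ` I)"

text \<open>The sum is the Minkowski sum of sets, from \<^theory>\<open>HOL-Library.Set_Algebras\<close>.\<close>

definition gen_permutohedron :: "nat \<Rightarrow> (nat set \<Rightarrow> real) \<Rightarrow> (nat, real) poly_mapping set" where
  "gen_permutohedron n y =
     (\<Sum>I\<in>Pow {1..n} - {{}}. (\<lambda>x. y I *\<^sub>R x) ` coord_simplex I)"

text \<open>
  Lebesgue measure on \<open>\<real>\<^sup>n\<^sup>-\<^sup>1\<close> is the product of the measures \<open>lborel\<close> over the coordinates
  \<open>1, \<dots>, n - 1\<close>; for \<open>n = 1\<close> the empty product gives a point measure \<open>1\<close>.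
\<close>

definition Vol :: "nat \<Rightarrow> (nat, real) poly_mapping set \<Rightarrow> real" where
  "Vol n P = measure (Pi\<^sub>M {1..<n} (\<lambda>_. lborel))
     ((\<lambda>t. restrict (Poly_Mapping.lookup t) {1..<n}) ` P)"

definition descent_set :: "nat \<Rightarrow> (nat \<Rightarrow> nat) \<Rightarrow> nat set" where
  "descent_set n w = {i\<in>{1..<n}. w i > w (i + 1)}"

definition eps_seq :: "nat \<Rightarrow> (nat \<Rightarrow> nat) \<Rightarrow> int list" where
  "eps_seq n c = butlast (concat (map (\<lambda>i. replicate (c i) 1 @ [-1]) [1..<n+1]))"

definition neg_prefix_set :: "nat \<Rightarrow> (nat \<Rightarrow> nat) \<Rightarrow> nat set" where
  "neg_prefix_set n c = {i\<in>{1..<n}. sum_list (take (2 * i - 1) (eps_seq n c)) < 0}"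

text \<open>A collection \<open>J\<^sub>1, \<dots>, J\<^sub>n\<^sub>-\<^sub>1\<close> is a function on \<open>{1..<n}\<close>.\<close>

definition collection_set :: "nat \<Rightarrow> (nat \<Rightarrow> nat set) \<Rightarrow> nat set" where
  "collection_set n J = neg_prefix_set n
     (Poly_Mapping.lookup (\<Sum>k\<in>{1..<n}. Poly_Mapping.single (Min (J k)) 1))"

end

theory Submission
  imports Defs "HOL-Combinatorics.Multiset_Permutations"
begin

text \<open>
  A generalized permutohedron with \<open>y \<ge> 0\<close> is the base polytope of the submodular function
  \<open>f S = (\<Sum>I meeting S. y I)\<close>. Sections of base polytopes by \<open>t\<^sub>n = s\<close> are again base polytopes,
  of \<open>min (f S) (f (S \<union> {n}) - s)\<close>, so the volume can be computed by integrating over sections.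
  By induction it equals a signed sum of divided-power monomials in the coordinates of the vertices,
  indexed by the orderings \<open>u\<close> of \<open>{1..n}\<close>. As \<open>s\<close> varies, the vertex of the section for an ordering
  \<open>u\<close> of \<open>{1..<n}\<close> moves along the path of edges through the vertices given by inserting \<open>n\<close> into \<open>u\<close>
  at successive positions. Integrating along this path and summing by parts produces for each
  insertion a difference of two old coefficients, which is the new coefficient.

  For the coverage function \<open>f\<close> the vertex coordinates are partial sums of the \<open>y I\<close>, and expanding
  the monomials yields the sum over \<open>J\<^sub>1, \<dots>, J\<^sub>n\<^sub>-\<^sub>1\<close>.
\<close>

subsection \<open>Divided-power monomials\<close>

text \<open>The induction needs a class of polytopes closed under sections, and nonnegative
  Minkowski sums of simplices are not such a class. In the sum of the three segments joining e_4 to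
  e_1, e_2 and e_3, the points with last coordinate 1 form an inverted triangle: up to the summand
  e_4, its vertices are e_1 + e_2, e_1 + e_3 and e_2 + e_3. Volumes are therefore computed for
  arbitrary submodular \<open>f\<close>, and \<open>y\<close> enters only at the end.

  The coordinate that is cut off carries the largest label. Inside an ordering it always creates an
  ascent before it and a descent after it, whatever its neighbours are, and so a difference of old
  coefficients can be a new one. The price is that the projection must retain this coordinate,
  whereas \<open>Vol\<close> forgets it. The induction forgets coordinate 1 instead, and a
  measure-preserving exchange of coordinates links the two projections.

  Divided powers keep integration free of constants; the factorial of n - 1 arises only when
  products over collections are gathered into monomials.\<close>

definition comps :: "'a set \<Rightarrow> nat \<Rightarrow> ('a \<Rightarrow> nat) set" where
  "comps B m = {a. (\<forall>x. x \<notin> B \<longrightarrow> a x = 0) \<and> sum a B = m}"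

lemma finite_comps [simp]: "finite B \<Longrightarrow> finite (comps B m)"
proof -
  assume B: "finite B"
  have "comps B m \<subseteq> {a. \<forall>x. (x \<in> B \<longrightarrow> a x \<in> {..m}) \<and> (x \<notin> B \<longrightarrow> a x = 0)}"
    using B by (auto simp: comps_def member_le_sum)
  then show ?thesis
    using finite_set_of_finite_funs[OF B, of "{..m}" 0] finite_subset by blast
qed

lemma comps_0: "finite B \<Longrightarrow> comps B 0 = {\<lambda>_. 0}"
  by (fastforce simp: comps_def)

text \<open>Lowering the exponent at \<open>y\<close> by one is a bijection from the vectors with
  \<open>a y\<close> positive onto \<open>comps B m\<close>. In both applications \<open>G\<close>
  vanishes on the other vectors because it contains the factor \<open>a y\<close> or the derivative
  of a power with exponent \<open>a y\<close>.\<close>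

lemma sum_comps_Suc:
  fixes G :: "('a \<Rightarrow> nat) \<Rightarrow> 'b::comm_monoid_add"
  assumes "finite B" "y \<in> B" and "\<And>a. a \<in> comps B (Suc m) \<Longrightarrow> a y = 0 \<Longrightarrow> G a = 0"
  shows "(\<Sum>a\<in>comps B (Suc m). G a) = (\<Sum>b\<in>comps B m. G (b(y := Suc (b y))))"
proof -
  have s: "sum (a(y := k)) B = k + sum a (B - {y})" for a :: "'a \<Rightarrow> nat" and k
    using assms by (subst sum.remove[of B y]) auto
  have s': "sum a B = a y + sum a (B - {y})" for a :: "'a \<Rightarrow> nat"
    using assms by (subst sum.remove[of B y]) auto
  have "(\<Sum>a\<in>comps B (Suc m). G a) = (\<Sum>a\<in>{a\<in>comps B (Suc m). a y \<noteq> 0}. G a)"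
    using assms by (intro sum.mono_neutral_right) auto
  also have "\<dots> = (\<Sum>b\<in>comps B m. G (b(y := Suc (b y))))"
    by (rule sum.reindex_bij_witness[of _ "\<lambda>b. b(y := Suc (b y))" "\<lambda>a. a(y := a y - 1)"])
       (use \<open>y \<in> B\<close> in \<open>auto simp: comps_def s s'\<close>)
  finally show ?thesis .
qed

definition dpow :: "'a set \<Rightarrow> ('a \<Rightarrow> real) \<Rightarrow> ('a \<Rightarrow> nat) \<Rightarrow> real" where
  "dpow B v a = (\<Prod>x\<in>B. v x ^ a x / fact (a x))"

lemma dpow_remove: "finite B \<Longrightarrow> y \<in> B \<Longrightarrow>
    dpow B v a = v y ^ a y / fact (a y) * dpow (B - {y}) v a"
  by (simp add: dpow_def prod.remove[of B y])

lemma dpow_cong: "(\<And>x. x \<in> B \<Longrightarrow> v x = v' x) \<Longrightarrow> (\<And>x. x \<in> B \<Longrightarrow> a x = a' x) \<Longrightarrow> dpow B v a = dpow B v' a'"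
  by (simp add: dpow_def)

lemma dpow_Suc: "finite B \<Longrightarrow> y \<in> B \<Longrightarrow>
    of_nat (Suc (a y)) * dpow B v (a(y := Suc (a y))) = v y * dpow B v a"
proof -
  assume B: "finite B" "y \<in> B"
  have "dpow (B - {y}) v (a(y := Suc (a y))) = dpow (B - {y}) v a"
    by (rule dpow_cong) auto
  then show ?thesis
    unfolding dpow_remove[OF B] by (simp add: field_simps del: of_nat_Suc)
qed

definition value_count :: "'k set \<Rightarrow> ('k \<Rightarrow> 'a) \<Rightarrow> 'a \<Rightarrow> nat" where
  "value_count A h x = card {k\<in>A. h k = x}"

text \<open>A weighted multinomial theorem: the tuples are grouped by how often each value of
  \<open>h\<close> occurs. Fixing one more index \<open>i\<close> raises one exponent, so the
  induction is over \<open>A\<close> with the weight \<open>G\<close> arbitrary.\<close>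

lemma sum_PiE_value_count:
  fixes A :: "'k set" and h :: "'j \<Rightarrow> 'a" and g :: "'j \<Rightarrow> real" and G :: "('a \<Rightarrow> nat) \<Rightarrow> real"
  assumes "finite A" "finite X" "finite B" "h ` X \<subseteq> B"
  shows "(\<Sum>J\<in>A \<rightarrow>\<^sub>E X. G (value_count A (\<lambda>k. h (J k))) * (\<Prod>k\<in>A. g (J k))) =
    fact (card A) * (\<Sum>a\<in>comps B (card A). G a * dpow B (\<lambda>x. \<Sum>j\<in>{j\<in>X. h j = x}. g j) a)"
  using assms(1)
proof (induction A arbitrary: G rule: finite_induct)
  case empty
  have "comps B 0 = {\<lambda>_. 0}" using assms by (intro comps_0)
  moreover have "value_count {} (\<lambda>k. h (J k)) = (\<lambda>_. 0)" for J :: "'k \<Rightarrow> 'j"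
    by (simp add: value_count_def fun_eq_iff)
  ultimately show ?case by (simp add: dpow_def)
next
  case (insert i A)
  define v where "v = (\<lambda>x. \<Sum>j\<in>{j\<in>X. h j = x}. g j)"
  define m where "m = card A"
  have co: "value_count (insert i A) (\<lambda>k. h ((J(i := j)) k)) = (value_count A (\<lambda>k. h (J k)))(h j := Suc (value_count A (\<lambda>k. h (J k)) (h j)))" for J j
  proof
    fix x
    have "{k \<in> insert i A. h ((J(i := j)) k) = x} = (if h j = x then insert i {k\<in>A. h (J k) = x} else {k\<in>A. h (J k) = x})"
      using insert by auto
    then show "value_count (insert i A) (\<lambda>k. h ((J(i := j)) k)) x = ((value_count A (\<lambda>k. h (J k)))(h j := Suc (value_count A (\<lambda>k. h (J k)) (h j)))) x"
      using insert by (auto simp: value_count_def)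
  qed
  have pr: "(\<Prod>k\<in>insert i A. g ((J(i := j)) k)) = g j * (\<Prod>k\<in>A. g (J k))" for J j
    using insert by (auto intro!: prod.cong)
  have "(\<Sum>J\<in>insert i A \<rightarrow>\<^sub>E X. G (value_count (insert i A) (\<lambda>k. h (J k))) * (\<Prod>k\<in>insert i A. g (J k)))
     = (\<Sum>(j, J)\<in>X \<times> (A \<rightarrow>\<^sub>E X). G (value_count (insert i A) (\<lambda>k. h ((J(i := j)) k))) * (\<Prod>k\<in>insert i A. g ((J(i := j)) k)))"
    unfolding PiE_insert_eq by (subst sum.reindex[OF inj_combinator[OF insert(2)]]) (simp add: case_prod_unfold)
  also have "\<dots> = (\<Sum>j\<in>X. g j * (\<Sum>J\<in>A \<rightarrow>\<^sub>E X. (\<lambda>a. G (a(h j := Suc (a (h j))))) (value_count A (\<lambda>k. h (J k))) * (\<Prod>k\<in>A. g (J k))))"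
    unfolding co pr by (simp add: sum.cartesian_product[symmetric] sum_distrib_left mult_ac)
  also have "\<dots> = (\<Sum>j\<in>X. g j * (fact m * (\<Sum>a\<in>comps B m. G (a(h j := Suc (a (h j)))) * dpow B v a)))"
    by (intro sum.cong refl arg_cong2[where f="(*)"])
       (use insert.IH[of "\<lambda>a. G (a(x := Suc (a x)))" for x] in \<open>simp add: v_def m_def\<close>)
  also have "\<dots> = (\<Sum>x\<in>B. \<Sum>j\<in>{j\<in>X. h j = x}. g j * (fact m * (\<Sum>a\<in>comps B m. G (a(h j := Suc (a (h j)))) * dpow B v a)))"
    using assms by (intro sum.group[symmetric])
  also have "\<dots> = (\<Sum>x\<in>B. v x * (fact m * (\<Sum>a\<in>comps B m. G (a(x := Suc (a x))) * dpow B v a)))"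
    by (simp add: v_def sum_distrib_right)
  also have "\<dots> = fact m * (\<Sum>x\<in>B. (\<Sum>a\<in>comps B m. G (a(x := Suc (a x))) * (real ((a(x := Suc (a x))) x) * dpow B v (a(x := Suc (a x))))))"
    unfolding sum_distrib_left
  proof (intro sum.cong refl)
    fix x a assume "x \<in> B" "a \<in> comps B m"
    have "real ((a(x := Suc (a x))) x) * dpow B v (a(x := Suc (a x))) = v x * dpow B v a"
      using dpow_Suc[OF \<open>finite B\<close> \<open>x \<in> B\<close>, of a v] by simp
    then show "v x * (fact m * (G (a(x := Suc (a x))) * dpow B v a)) = fact m * (G (a(x := Suc (a x))) * (real ((a(x := Suc (a x))) x) * dpow B v (a(x := Suc (a x)))))"
      by (simp only: mult_ac)
  qed
  also have "\<dots> = fact m * (\<Sum>x\<in>B. (\<Sum>a\<in>comps B (Suc m). G a * (real (a x) * dpow B v a)))"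
    using assms by (intro arg_cong2[where f="(*)"] sum.cong refl sum_comps_Suc[symmetric]) auto
  \<comment> \<open>The factors \<open>a x\<close>, one for each exponent that may have been raised
    last, add up to the degree \<open>Suc m\<close>, which completes the factorial.\<close>
  also have "\<dots> = fact m * (\<Sum>a\<in>comps B (Suc m). G a * (real (sum a B) * dpow B v a))"
    by (subst sum.swap) (simp add: sum_distrib_left sum_distrib_right)
  also have "\<dots> = fact (Suc m) * (\<Sum>a\<in>comps B (Suc m). G a * dpow B v a)"
    by (simp add: comps_def sum_distrib_left mult_ac)
  finally show ?case using insert by (simp add: v_def m_def)
qed

subsection \<open>Descent signs\<close>

text \<open>
  \<open>desc_sign a 0 u\<close> is the coefficient with which the monomial \<open>a\<close> of the vertex belonging to the
  ordering \<open>u\<close> contributes to the volume: the sign \<open>(-1) ^ d\<close> if the \<open>d\<close> descents of \<open>u\<close> are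
  exactly the positions \<open>i\<close> with \<open>a u\<^sub>1 + \<dots> + a u\<^sub>i < i\<close>, and \<open>0\<close> otherwise. The accumulator
  carries \<open>a u\<^sub>1 + \<dots> + a u\<^sub>i - i\<close>; integer exponents allow entries to be decremented freely.
\<close>

definition sgn_factor :: "int \<Rightarrow> bool \<Rightarrow> real" where
  "sgn_factor e D = (if e < 0 then (if D then -1 else 0) else (if D then 0 else 1))"

fun desc_sign :: "(nat \<Rightarrow> int) \<Rightarrow> int \<Rightarrow> nat list \<Rightarrow> real" where
  "desc_sign a e (x # y # zs) = sgn_factor (e + a x - 1) (x > y) * desc_sign a (e + a x - 1) (y # zs)"
| "desc_sign a e _ = 1"

lemma desc_sign_append:
  "desc_sign a e (xs @ z # y # ys) = desc_sign a e (xs @ [z]) *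
     sgn_factor (e + sum_list (map a (xs @ [z])) - int (length (xs @ [z]))) (z > y) *
     desc_sign a (e + sum_list (map a (xs @ [z])) - int (length (xs @ [z]))) (y # ys)"
proof (induction xs arbitrary: e)
  case Nil then show ?case by simp
next
  case (Cons x xs)
  then show ?case by (cases xs) (simp_all add: algebra_simps)
qed

lemma desc_sign_cong:
  "(\<And>x. x \<in> set (butlast u) \<Longrightarrow> a x = a' x) \<Longrightarrow> desc_sign a e u = desc_sign a' e u"
  by (induction a e u rule: desc_sign.induct) auto

text \<open>The exponent of the first entry is seen only through its sum with the accumulator, and
  distinctness excludes a later occurrence of \<open>y\<close>.\<close>

lemma desc_sign_shift:
  assumes "distinct (y # ys)"
  shows "desc_sign (a(y := a y - 1)) e (y # ys) = desc_sign a (e - 1) (y # ys)"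
proof (cases ys)
  case (Cons z zs)
  then show ?thesis using assms
    by (auto simp: algebra_simps intro!: desc_sign_cong dest: in_set_butlastD)
qed simp

text \<open>Decrementing at \<open>z\<close> lowers the accumulator from the position after
  \<open>z\<close> on, decrementing at \<open>y\<close> only from the position after
  \<open>y\<close> on. The two terms on the right thus differ only in the factor for the pair
  \<open>z\<close>, \<open>y\<close>. On the left this factor is replaced by the two factors around
  \<open>M\<close>, an ascent and a descent.\<close>

lemma desc_sign_insert_mid:
  assumes d: "distinct (xs @ z # y # ys)" and M: "\<And>x. x \<in> set (xs @ z # y # ys) \<Longrightarrow> x < M" and a: "a M = 0"
  shows "desc_sign a e (xs @ z # M # y # ys) =
    desc_sign (a(z := a z - 1)) e (xs @ z # y # ys) - desc_sign (a(y := a y - 1)) e (xs @ z # y # ys)"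
proof -
  let ?s = "e + sum_list (map a (xs @ [z])) - int (length (xs @ [z]))"
  define a1 where "a1 = a(z := a z - 1)"
  define a2 where "a2 = a(y := a y - 1)"
  have "sum_list (map a1 xs) = sum_list (map a xs)" "sum_list (map a2 xs) = sum_list (map a xs)"
    using d by (auto simp: a1_def a2_def intro!: arg_cong[where f=sum_list])
  then have s1: "e + sum_list (map a1 (xs @ [z])) - int (length (xs @ [z])) = ?s - 1"
    and s2: "e + sum_list (map a2 (xs @ [z])) - int (length (xs @ [z])) = ?s"
    using d by (auto simp: a1_def a2_def)
  have f: "desc_sign a1 e (xs @ [z]) = desc_sign a e (xs @ [z])" "desc_sign a1 (?s - 1) (y # ys) = desc_sign a (?s - 1) (y # ys)"
    "desc_sign a2 e (xs @ [z]) = desc_sign a e (xs @ [z])"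
    by (rule desc_sign_cong; use d in \<open>auto simp: a1_def a2_def dest: in_set_butlastD split: if_splits\<close>)+
  have g: "desc_sign a2 ?s (y # ys) = desc_sign a (?s - 1) (y # ys)"
    unfolding a2_def by (rule desc_sign_shift) (use d in auto)
  have 1: "desc_sign a1 e (xs @ z # y # ys) = desc_sign a e (xs @ [z]) * sgn_factor (?s - 1) (z > y) * desc_sign a (?s - 1) (y # ys)"
    and 2: "desc_sign a2 e (xs @ z # y # ys) = desc_sign a e (xs @ [z]) * sgn_factor ?s (z > y) * desc_sign a (?s - 1) (y # ys)"
    by (simp_all only: desc_sign_append[of _ _ xs z y ys] s1 s2 f g)
  have 3: "desc_sign a e (xs @ z # M # y # ys) = desc_sign a e (xs @ [z]) * sgn_factor ?s False * (sgn_factor (?s - 1) True * desc_sign a (?s - 1) (y # ys))"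
    apply (subst desc_sign_append)
    using M[of z] M[of y] a by simp
  \<comment> \<open>Both sides are -1 if \<open>?s = 0\<close> and 0 otherwise, independently of the
    comparison of \<open>z\<close> with \<open>y\<close>.\<close>
  have 4: "sgn_factor ?s False * sgn_factor (?s - 1) True = sgn_factor (?s - 1) (z > y) - sgn_factor ?s (z > y)"
    by (auto simp: sgn_factor_def)
  have "desc_sign a e (xs @ z # M # y # ys) =
      desc_sign a e (xs @ [z]) * (sgn_factor ?s False * sgn_factor (?s - 1) True) * desc_sign a (?s - 1) (y # ys)"
    unfolding 3 by (simp only: mult.assoc)
  also have "\<dots> = desc_sign a1 e (xs @ z # y # ys) - desc_sign a2 e (xs @ z # y # ys)"
    unfolding 1 2 4 by (simp only: left_diff_distrib right_diff_distrib)
  finally show ?thesis unfolding a1_def a2_def .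
qed

text \<open>In front, \<open>M\<close> is followed by a descent while the accumulator is -1. This
  contributes the factor -1 and starts the rest at -1, which amounts to decrementing at
  \<open>y\<close>.\<close>

lemma desc_sign_insert_front:
  assumes d: "distinct (y # ys)" and M: "y < M" and a: "a M = 0"
  shows "desc_sign a 0 (M # y # ys) = - desc_sign (a(y := a y - 1)) 0 (y # ys)"
  unfolding desc_sign_shift[OF d] using M a by (simp add: sgn_factor_def)

text \<open>By the hypothesis on the total degree the accumulator before \<open>M\<close> is 0, so
  the final ascent contributes 1. The decrement at \<open>z\<close> is invisible because
  \<open>desc_sign\<close> ignores the exponent of the last entry.\<close>

lemma desc_sign_insert_back:
  assumes d: "distinct (xs @ [z])" and M: "z < M"
    and s: "sum_list (map a (xs @ [z])) = int (length (xs @ [z]))"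
  shows "desc_sign a 0 (xs @ [z, M]) = desc_sign (a(z := a z - 1)) 0 (xs @ [z])"
proof -
  have "desc_sign a 0 (xs @ z # M # []) = desc_sign a 0 (xs @ [z])"
    unfolding desc_sign_append s using M by (simp add: sgn_factor_def)
  also have "\<dots> = desc_sign (a(z := a z - 1)) 0 (xs @ [z])"
    by (rule desc_sign_cong) (use d in auto)
  finally show ?thesis by simp
qed

text \<open>In the middle, the ascent before \<open>M\<close> requires a nonnegative accumulator,
  and a positive \<open>a M\<close> keeps it nonnegative at the descent after \<open>M\<close>,
  where it would have to be negative. At the front the descent alone fails. At the end the degree
  condition makes the accumulator before \<open>M\<close> equal to \<open>- a M\<close>,
  contradicting the ascent.\<close>

lemma desc_sign_max_zero:
  assumes M: "\<And>x. x \<in> set (xs @ ys) \<Longrightarrow> x < M" and a: "a M > 0" and ne: "xs @ ys \<noteq> []"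
    and s: "sum_list (map a (xs @ M # ys)) = int (length (xs @ ys))"
  shows "desc_sign a 0 (xs @ M # ys) = 0"
proof (cases xs rule: rev_cases)
  case Nil
  then obtain y ys' where "ys = y # ys'" using ne by (cases ys) auto
  then show ?thesis using Nil M[of y] a by (simp add: sgn_factor_def)
next
  case (snoc xs' z)
  show ?thesis
  proof (cases ys)
    case Nil
    then have "desc_sign a 0 (xs' @ z # M # []) = 0"
      using snoc s M[of z] a by (subst desc_sign_append) (auto simp: sgn_factor_def)
    then show ?thesis using Nil snoc by simp
  next
    case (Cons y ys')
    have "desc_sign a 0 (xs' @ z # M # y # ys') = 0"
      using snoc Cons M[of z] M[of y] a by (subst desc_sign_append) (auto simp: sgn_factor_def)
    then show ?thesis using Cons snoc by simp
  qed
qed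

lemma desc_sign_prod:
  "desc_sign a e u = (\<Prod>i\<in>{1..<length u}. sgn_factor (e + (\<Sum>k<i. a (u ! k)) - int i) (u ! (i - 1) > u ! i))"
proof (induction a e u rule: desc_sign.induct)
  case (1 a e x y zs)
  let ?n = "length (y # zs)"
  have "(\<Prod>i\<in>{1..<Suc ?n}. sgn_factor (e + (\<Sum>k<i. a ((x # y # zs) ! k)) - int i) ((x # y # zs) ! (i - 1) > (x # y # zs) ! i))
     = sgn_factor (e + a x - 1) (x > y) * (\<Prod>i\<in>{Suc 1..<Suc ?n}. sgn_factor (e + (\<Sum>k<i. a ((x # y # zs) ! k)) - int i) ((x # y # zs) ! (i - 1) > (x # y # zs) ! i))"
    by (subst prod.atLeast_Suc_lessThan) auto
  also have "(\<Prod>i\<in>{Suc 1..<Suc ?n}. sgn_factor (e + (\<Sum>k<i. a ((x # y # zs) ! k)) - int i) ((x # y # zs) ! (i - 1) > (x # y # zs) ! i))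
    = desc_sign a (e + a x - 1) (y # zs)"
    unfolding 1 prod.shift_bounds_Suc_ivl
    by (intro prod.cong arg_cong2[where f=sgn_factor]) (auto simp: sum.lessThan_Suc_shift nth_Cons' simp del: sum.lessThan_Suc)
  finally show ?case by simp
qed auto

lemma prod_sgn_factor:
  assumes "finite A"
  shows "(\<Prod>i\<in>A. sgn_factor (e i) (D i)) = (if {i\<in>A. e i < 0} = {i\<in>A. D i} then (-1) ^ card {i\<in>A. e i < 0} else 0)"
proof (cases "\<forall>i\<in>A. e i < 0 \<longleftrightarrow> D i")
  case True
  have "(\<Prod>i\<in>A. sgn_factor (e i) (D i)) = (\<Prod>i\<in>A. if e i < 0 then -1 else 1)"
    using True by (intro prod.cong) (auto simp: sgn_factor_def)
  also have "\<dots> = (-1) ^ card {i\<in>A. e i < 0}"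
    using assms by (simp add: prod.If_cases Int_def)
  also have "{i\<in>A. e i < 0} = {i\<in>A. D i}"
    using True by (intro Collect_cong) auto
  finally show ?thesis by (simp add: \<open>{i\<in>A. e i < 0} = {i\<in>A. D i}\<close>)
next
  case False
  then obtain i where i: "i \<in> A" "(e i < 0) \<noteq> D i" by auto
  then have "sgn_factor (e i) (D i) = 0" by (auto simp: sgn_factor_def)
  then have "(\<Prod>i\<in>A. sgn_factor (e i) (D i)) = 0"
    using assms i(1) by (intro prod_zero) auto
  moreover have "{i\<in>A. e i < 0} \<noteq> {i\<in>A. D i}"
    using i by (auto simp: set_eq_iff)
  ultimately show ?thesis by simp
qed

subsection \<open>Base polytopes and their sections\<close>

definition submodular :: "nat \<Rightarrow> (nat set \<Rightarrow> real) \<Rightarrow> bool" where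
  "submodular n f \<longleftrightarrow> f {} = 0 \<and>
     (\<forall>X Y. X \<subseteq> {1..n} \<longrightarrow> Y \<subseteq> {1..n} \<longrightarrow> f (X \<union> Y) + f (X \<inter> Y) \<le> f X + f Y)"

definition base_polytope :: "nat \<Rightarrow> (nat set \<Rightarrow> real) \<Rightarrow> (nat \<Rightarrow> real) set" where
  "base_polytope n f = {t. sum t {1..n} = f {1..n} \<and> (\<forall>S\<subseteq>{1..n}. sum t S \<le> f S)}"

text \<open>The function whose base polytope is the section \<open>t M = s\<close> of the base polytope of \<open>f\<close>.\<close>

definition slice :: "(nat set \<Rightarrow> real) \<Rightarrow> nat \<Rightarrow> real \<Rightarrow> nat set \<Rightarrow> real" where
  "slice f M s S = min (f S) (f (insert M S) - s)"

definition marginal :: "(nat set \<Rightarrow> real) \<Rightarrow> nat \<Rightarrow> nat set \<Rightarrow> real" where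
  "marginal f M S = f (insert M S) - f S"

text \<open>The coordinates of the vertex that the greedy algorithm finds for the ordering \<open>u\<close>.\<close>

definition vertex :: "(nat set \<Rightarrow> real) \<Rightarrow> nat list \<Rightarrow> nat \<Rightarrow> real" where
  "vertex f u x = marginal f x (set (takeWhile (\<lambda>z. z \<noteq> x) u))"

lemma submodularD: "submodular n f \<Longrightarrow> X \<subseteq> {1..n} \<Longrightarrow> Y \<subseteq> {1..n} \<Longrightarrow> f (X \<union> Y) + f (X \<inter> Y) \<le> f X + f Y"
  by (simp add: submodular_def)

text \<open>Diminishing returns. Along an ordering of \<open>{1..n}\<close> the marginals of
  \<open>Suc n\<close> decrease, so they cut the range of the section height into consecutive
  intervals.\<close>

lemma marginal_antimono:
  assumes "submodular (Suc n) f" "Y \<subseteq> {1..n}" "X \<subseteq> Y"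
  shows "marginal f (Suc n) Y \<le> marginal f (Suc n) X"
proof -
  have "insert (Suc n) X \<union> Y = insert (Suc n) Y" "insert (Suc n) X \<inter> Y = X"
    using assms by auto
  moreover have "insert (Suc n) X \<subseteq> {1..Suc n}" "Y \<subseteq> {1..Suc n}"
    using assms by (auto dest!: subsetD)
  ultimately show ?thesis
    using submodularD[OF assms(1), of "insert (Suc n) X" Y] by (simp add: marginal_def)
qed

lemma slice_low: "s \<le> marginal f M X \<Longrightarrow> slice f M s X = f X"
  and slice_high: "marginal f M X \<le> s \<Longrightarrow> slice f M s X = f (insert M X) - s"
  by (auto simp: slice_def marginal_def)

text \<open>Each of the two minima on the right is attained with or without \<open>Suc n\<close>
  adjoined. In each of the four cases submodularity of \<open>f\<close> at the corresponding pair
  bounds the left side. The bound on \<open>s\<close> gives the value 0 at the empty set.\<close>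

lemma submodular_slice:
  assumes f: "submodular (Suc n) f" and s: "s \<le> f {Suc n}"
  shows "submodular n (slice f (Suc n) s)"
  unfolding submodular_def
proof (intro conjI allI impI)
  show "slice f (Suc n) s {} = 0"
    using f s by (simp add: submodular_def slice_def)
next
  fix X Y :: "nat set"
  assume XY: "X \<subseteq> {1..n}" "Y \<subseteq> {1..n}"
  let ?M = "Suc n"
  have sub: "X \<subseteq> {1..?M}" "Y \<subseteq> {1..?M}" "insert ?M X \<subseteq> {1..?M}" "insert ?M Y \<subseteq> {1..?M}"
    using XY by (auto dest!: subsetD)
  have M: "?M \<notin> X" "?M \<notin> Y" using XY by auto
  have "f (X \<union> Y) + f (X \<inter> Y) \<le> f X + f Y"
    using submodularD[OF f sub(1,2)] .
  moreover have "f (insert ?M (X \<union> Y)) + f (X \<inter> Y) \<le> f X + f (insert ?M Y)"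
    using submodularD[OF f sub(1,4)] M by (simp add: Int_insert_right)
  moreover have "f (insert ?M (X \<union> Y)) + f (X \<inter> Y) \<le> f (insert ?M X) + f Y"
    using submodularD[OF f sub(3,2)] M by (simp add: Int_insert_left)
  moreover have "f (insert ?M (X \<union> Y)) + f (insert ?M (X \<inter> Y)) \<le> f (insert ?M X) + f (insert ?M Y)"
    using submodularD[OF f sub(3,4)] M by (simp add: Int_insert_left)
  ultimately show "slice f ?M s (X \<union> Y) + slice f ?M s (X \<inter> Y) \<le> slice f ?M s X + slice f ?M s Y"
    unfolding slice_def min_def by (auto split: if_splits)
qed

text \<open>Constraints on sets containing \<open>Suc n\<close> become constraints on the remaining
  elements with \<open>t (Suc n)\<close> moved to the right, and the minimum in \<open>slice\<close>
  collects both kinds. The upper bound on the height is the constraint of the singleton; the lower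
  bound ensures that the full set takes the second branch of the minimum, as the total
  requires.\<close>

lemma base_polytope_slice:
  assumes f: "submodular (Suc n) f"
  shows "t \<in> base_polytope (Suc n) f \<longleftrightarrow>
    marginal f (Suc n) {1..n} \<le> t (Suc n) \<and> t (Suc n) \<le> f {Suc n} \<and>
    t \<in> base_polytope n (slice f (Suc n) (t (Suc n)))"
    (is "?L \<longleftrightarrow> ?R")
proof
  have N: "{1..Suc n} = insert (Suc n) {1..n}" by auto
  have sM: "sum t (insert (Suc n) S) = t (Suc n) + sum t S" if "S \<subseteq> {1..n}" for S
    using that finite_subset[OF that] by (subst sum.insert) auto
  {
    assume ?L
    then have tot: "t (Suc n) + sum t {1..n} = f (insert (Suc n) {1..n})"
      and le: "\<And>S. S \<subseteq> insert (Suc n) {1..n} \<Longrightarrow> sum t S \<le> f S"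
      using sM[of "{1..n}"] unfolding base_polytope_def N by auto
    have 1: "sum t S \<le> f S" "t (Suc n) + sum t S \<le> f (insert (Suc n) S)" if "S \<subseteq> {1..n}" for S
    proof -
      have "S \<subseteq> insert (Suc n) {1..n}" "insert (Suc n) S \<subseteq> insert (Suc n) {1..n}" using that by auto
      then show "sum t S \<le> f S" "t (Suc n) + sum t S \<le> f (insert (Suc n) S)"
        using le sM[OF that] by metis+
    qed
    have "sum t {1..n} \<le> f {1..n}" "t (Suc n) \<le> f {Suc n}"
      using 1(1)[of "{1..n}"] 1(2)[of "{}"] by auto
    then have "marginal f (Suc n) {1..n} \<le> t (Suc n)" "sum t {1..n} = slice f (Suc n) (t (Suc n)) {1..n}"
      using tot unfolding slice_def marginal_def by linarith+
    moreover have "sum t S \<le> slice f (Suc n) (t (Suc n)) S" if "S \<subseteq> {1..n}" for S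
      using 1[OF that] by (simp add: slice_def)
    ultimately show ?R
      using \<open>t (Suc n) \<le> f {Suc n}\<close> by (simp add: base_polytope_def)
  }
  {
    assume R: ?R
    then have tot: "sum t {1..n} = f (insert (Suc n) {1..n}) - t (Suc n)"
      and le: "\<And>S. S \<subseteq> {1..n} \<Longrightarrow> sum t S \<le> f S"
        "\<And>S. S \<subseteq> {1..n} \<Longrightarrow> sum t S \<le> f (insert (Suc n) S) - t (Suc n)"
      by (auto simp: base_polytope_def slice_def marginal_def)
    have "sum t S \<le> f S" if S: "S \<subseteq> {1..Suc n}" for S
    proof (cases "Suc n \<in> S")
      case True
      then have "S = insert (Suc n) (S - {Suc n})" "S - {Suc n} \<subseteq> {1..n}"
        using S by (auto simp: N)
      then show ?thesis using sM[of "S - {Suc n}"] le(2)[of "S - {Suc n}"] by simp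
    next
      case False
      then have "S \<subseteq> {1..n}" using S unfolding N by blast
      then show ?thesis by (rule le)
    qed
    then show ?L using tot sM[of "{1..n}"] unfolding base_polytope_def N by simp
  }
qed

lemma base_polytope_cong:
  assumes "\<And>x. x \<in> {1..n} \<Longrightarrow> t x = t' x"
  shows "t \<in> base_polytope n f \<longleftrightarrow> t' \<in> base_polytope n f"
proof -
  have "sum t S = sum t' S" if "S \<subseteq> {1..n}" for S
    using assms that by (intro sum.cong) auto
  then show ?thesis by (simp add: base_polytope_def)
qed

lemma takeWhile_neq_mid:
  "x \<notin> set xs \<Longrightarrow> takeWhile (\<lambda>z. z \<noteq> x) (xs @ x # ys) = xs"
  "x \<in> set xs \<Longrightarrow> takeWhile (\<lambda>z. z \<noteq> x) (xs @ ys) = takeWhile (\<lambda>z. z \<noteq> x) xs"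
  "x \<notin> set xs \<Longrightarrow> takeWhile (\<lambda>z. z \<noteq> x) (xs @ ys) = xs @ takeWhile (\<lambda>z. z \<noteq> x) ys"
  by (induction xs) auto

lemma vertex_insert:
  assumes u: "set (xs @ y # ys) = {1..n}" "distinct (xs @ y # ys)"
  defines "M \<equiv> Suc n"
  shows "vertex f (xs @ M # y # ys) M = marginal f M (set xs)"
    and "vertex f (xs @ y # M # ys) M = marginal f M (insert y (set xs))"
    and "vertex f (xs @ M # y # ys) y = f (insert M (insert y (set xs))) - f (insert M (set xs))"
    and "vertex f (xs @ y # M # ys) y = f (insert y (set xs)) - f (set xs)"
proof -
  have "M \<notin> set (xs @ y # ys)" unfolding u M_def by simp
  moreover have "y \<notin> set xs" using u by auto
  ultimately show "vertex f (xs @ M # y # ys) M = marginal f M (set xs)"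
    "vertex f (xs @ y # M # ys) M = marginal f M (insert y (set xs))"
    "vertex f (xs @ M # y # ys) y = f (insert M (insert y (set xs))) - f (insert M (set xs))"
    "vertex f (xs @ y # M # ys) y = f (insert y (set xs)) - f (set xs)"
    by (simp_all add: vertex_def marginal_def takeWhile_neq_mid(1,3) insert_commute)
qed

text \<open>Marginals decrease along the chain of prefixes, so \<open>slice\<close> equals
  \<open>f\<close> on all sets up to \<open>set xs\<close> and the shifted
  \<open>f (insert M _)\<close> on all sets from \<open>insert y (set xs)\<close> on. Only the
  coordinate at \<open>y\<close> straddles the switch. All others are differences within one branch,
  where \<open>s\<close> cancels.\<close>

lemma vertex_slice:
  assumes f: "submodular (Suc n) f"
    and u: "set (xs @ y # ys) = {1..n}" "distinct (xs @ y # ys)"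
    and s: "marginal f (Suc n) (insert y (set xs)) \<le> s" "s \<le> marginal f (Suc n) (set xs)"
  defines "M \<equiv> Suc n"
  shows "vertex (slice f M s) (xs @ y # ys) y = f (insert M (insert y (set xs))) - s - f (set xs)"
    and "x \<in> {1..n} \<Longrightarrow> x \<noteq> y \<Longrightarrow> vertex (slice f M s) (xs @ y # ys) x = vertex f (xs @ M # y # ys) x"
    and "x \<in> {1..n} \<Longrightarrow> x \<noteq> y \<Longrightarrow> vertex (slice f M s) (xs @ y # ys) x = vertex f (xs @ y # M # ys) x"
proof -
  have M: "M \<notin> set (xs @ y # ys)" unfolding u M_def by simp
  have y: "y \<notin> set xs" using u by auto
  have lo: "slice f M s B = f B" if "B \<subseteq> set xs" for B
  proof (rule slice_low)
    have "set xs \<subseteq> {1..n}" using u by auto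
    from marginal_antimono[OF f this that] show "s \<le> marginal f M B" using s by (simp add: M_def)
  qed
  have hi: "slice f M s B = f (insert M B) - s" if "insert y (set xs) \<subseteq> B" "B \<subseteq> {1..n}" for B
    using marginal_antimono[OF f that(2,1)] s by (intro slice_high) (auto simp: M_def)
  have yx: "insert y (set xs) \<subseteq> {1..n}" using u by auto
  show "vertex (slice f M s) (xs @ y # ys) y = f (insert M (insert y (set xs))) - s - f (set xs)"
    using y hi[OF _ yx] by (simp add: vertex_def marginal_def takeWhile_neq_mid lo)
  assume x: "x \<in> {1..n}" "x \<noteq> y"
  have "x \<noteq> M" using x by (auto simp: M_def)
  show "vertex (slice f M s) (xs @ y # ys) x = vertex f (xs @ M # y # ys) x"
    "vertex (slice f M s) (xs @ y # ys) x = vertex f (xs @ y # M # ys) x"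
  proof -
    consider "x \<in> set xs" | "x \<notin> set xs" "x \<in> set ys" using x u by fastforce
    then have "vertex (slice f M s) (xs @ y # ys) x = vertex f (xs @ M # y # ys) x \<and>
      vertex (slice f M s) (xs @ y # ys) x = vertex f (xs @ y # M # ys) x"
    proof cases
      case 1
      have "set (takeWhile (\<lambda>z. z \<noteq> x) xs) \<subseteq> set xs" by (auto dest: set_takeWhileD)
      then show ?thesis
        using 1 by (simp add: vertex_def marginal_def takeWhile_neq_mid lo)
    next
      case 2
      define B where "B = insert y (set xs \<union> set (takeWhile (\<lambda>z. z \<noteq> x) ys))"
      have "B \<subseteq> {1..n}" "insert x B \<subseteq> {1..n}"
        using x(1) unfolding B_def u(1)[symmetric] by (auto dest: set_takeWhileD)
      then have "slice f M s B = f (insert M B) - s" "slice f M s (insert x B) = f (insert M (insert x B)) - s"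
        by (intro hi; auto simp: B_def)+
      moreover have "set (takeWhile (\<lambda>z. z \<noteq> x) (xs @ y # ys)) = B" "set (takeWhile (\<lambda>z. z \<noteq> x) (xs @ M # y # ys)) = insert M B"
         "set (takeWhile (\<lambda>z. z \<noteq> x) (xs @ y # M # ys)) = insert M B"
        using 2 x \<open>x \<noteq> M\<close> by (auto simp: B_def takeWhile_neq_mid)
      ultimately show ?thesis by (simp add: vertex_def marginal_def insert_commute)
    qed
    then show "vertex (slice f M s) (xs @ y # ys) x = vertex f (xs @ M # y # ys) x"
      "vertex (slice f M s) (xs @ y # ys) x = vertex f (xs @ y # M # ys) x" by auto
  qed
qed

text \<open>A discrete intermediate value argument; \<open>P\<close> accumulates the prefix already
  passed.\<close>

lemma obtain_crossing:
  fixes m :: "'a set \<Rightarrow> real"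
  assumes "u \<noteq> []" "m (P \<union> set u) \<le> s" "s \<le> m P"
  obtains xs y ys where "u = xs @ y # ys" "m (insert y (P \<union> set xs)) \<le> s" "s \<le> m (P \<union> set xs)"
proof -
  have "\<exists>xs y ys. u = xs @ y # ys \<and> m (insert y (P \<union> set xs)) \<le> s \<and> s \<le> m (P \<union> set xs)"
    using assms
  proof (induction u arbitrary: P)
    case (Cons y u)
    show ?case
    proof (cases "m (insert y P) \<le> s")
      case True
      then show ?thesis using Cons.prems by (intro exI[of _ "[]"]) auto
    next
      case False
      then have "u \<noteq> []" using Cons.prems by auto
      then obtain xs z ys where "u = xs @ z # ys" "m (insert z (insert y P \<union> set xs)) \<le> s" "s \<le> m (insert y P \<union> set xs)"
        using Cons.IH[of "insert y P"] Cons.prems False by auto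
      then show ?thesis by (intro exI[of _ "y # xs"]) auto
    qed
  qed simp
  then show thesis using that by blast
qed

text \<open>Membership in a base polytope leaves coordinates outside \<open>{1..n}\<close>
  unconstrained; \<open>point\<close> discards them and moves to the vector space in which the
  simplices are defined.\<close>

definition point :: "nat \<Rightarrow> (nat \<Rightarrow> real) \<Rightarrow> (nat, real) poly_mapping" where
  "point n t = (\<Sum>i\<in>{1..n}. Poly_Mapping.single i (t i))"

lemma lookup_sum_pm: "Poly_Mapping.lookup (sum g A) i = (\<Sum>k\<in>A. Poly_Mapping.lookup (g k) i)"
  by (induction A rule: infinite_finite_induct) (auto simp: lookup_add)

lemma lookup_point: "Poly_Mapping.lookup (point n t) i = (if i \<in> {1..n} then t i else 0)"
  by (simp add: point_def lookup_sum_pm lookup_single when_def)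

lemma lookup_scaleR: "Poly_Mapping.lookup (c *\<^sub>R x) i = c *\<^sub>R Poly_Mapping.lookup x i"
  by (simp add: scaleR_poly_mapping_def)

text \<open>
  A vertex of a section lies on the edge joining the two vertices obtained by inserting \<open>n + 1\<close>
  just before and just after the coordinate that varies.
\<close>

lemma base_polytope_subset_hull:
  assumes "n \<ge> 1" "submodular n f" "t \<in> base_polytope n f"
  shows "point n t \<in> convex hull ((\<lambda>u. point n (vertex f u)) ` permutations_of_set {1..n})"
  using assms
proof (induction n arbitrary: f t rule: nat_induct_at_least)
  case base
  then have "point 1 t = point 1 (vertex f [1])"
    by (simp add: point_def vertex_def marginal_def base_polytope_def submodular_def)
  then show ?case by (intro hull_inc) auto
next
  case (Suc n)
  let ?M = "Suc n" and ?H = "convex hull ((\<lambda>u. point (Suc n) (vertex f u)) ` permutations_of_set {1..Suc n})"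
  define s where "s = t ?M"
  define e where "e = Poly_Mapping.single ?M s"
  have s: "marginal f ?M {1..n} \<le> s" "s \<le> f {?M}" "t \<in> base_polytope n (slice f ?M s)"
    using Suc.prems base_polytope_slice[OF Suc.prems(1), of t] by (auto simp: s_def)
  have "s \<le> marginal f ?M {}" using s Suc.prems by (simp add: marginal_def submodular_def)
  have "point n t \<in> convex hull ((\<lambda>u. point n (vertex (slice f ?M s) u)) ` permutations_of_set {1..n})"
    using s by (intro Suc.IH submodular_slice Suc.prems)
  \<comment> \<open>Translation by \<open>e\<close> lifts the section from the lower space back to
    height \<open>s\<close>.\<close>
  then have "e + point n t \<in> convex hull ((+) e ` (\<lambda>u. point n (vertex (slice f ?M s) u)) ` permutations_of_set {1..n})"
    by (subst convex_hull_translation) auto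
  also have "\<dots> \<subseteq> ?H"
  proof (rule hull_minimal)
    show "convex ?H" by (rule convex_convex_hull)
    show "(+) e ` (\<lambda>u. point n (vertex (slice f ?M s) u)) ` permutations_of_set {1..n} \<subseteq> ?H"
    proof clarify
      fix u assume "u \<in> permutations_of_set {1..n}"
      then have u: "set u = {1..n}" "distinct u" by (auto dest: permutations_of_setD)
      then have "u \<noteq> []" using Suc.hyps by auto
      then obtain xs y ys where uxy: "u = xs @ y # ys" and "marginal f ?M (insert y ({} \<union> set xs)) \<le> s" "s \<le> marginal f ?M ({} \<union> set xs)"
        using obtain_crossing[of u "marginal f ?M" "{}" s thesis] s \<open>s \<le> marginal f ?M {}\<close> u by auto
      then have m: "marginal f ?M (insert y (set xs)) \<le> s" "s \<le> marginal f ?M (set xs)" by auto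
      define w1 where "w1 = xs @ ?M # y # ys"
      define w2 where "w2 = xs @ y # ?M # ys"
      have w: "w1 \<in> permutations_of_set {1..?M}" "w2 \<in> permutations_of_set {1..?M}"
      proof -
        have "?M \<notin> set u" using u by simp
        moreover have "{1..?M} = insert ?M (set u)" using u by auto
        ultimately show "w1 \<in> permutations_of_set {1..?M}" "w2 \<in> permutations_of_set {1..?M}"
          using u unfolding w1_def w2_def permutations_of_set_def uxy by auto
      qed
      \<comment> \<open>The parameter \<theta> is read off from coordinate \<open>?M\<close>.
        Coordinate \<open>y\<close> then fits because its sum with coordinate \<open>?M\<close> is
        constant on the edge.\<close>
      have "s \<in> closed_segment (marginal f ?M (set xs)) (marginal f ?M (insert y (set xs)))"
        using m by (auto simp: closed_segment_eq_real_ivl)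
      then obtain \<theta> where \<theta>: "0 \<le> \<theta>" "\<theta> \<le> 1" "s = (1 - \<theta>) * marginal f ?M (set xs) + \<theta> * marginal f ?M (insert y (set xs))"
        by (auto simp: closed_segment_def)
      note u' = u[unfolded uxy]
      have "e + point n (vertex (slice f ?M s) u) = (1 - \<theta>) *\<^sub>R point ?M (vertex f w1) + \<theta> *\<^sub>R point ?M (vertex f w2)"
      proof (rule poly_mapping_eqI)
        fix i
        consider "i = ?M" | "i = y" | "i \<in> {1..n}" "i \<noteq> y" | "i \<notin> {1..?M}" by fastforce
        then show "Poly_Mapping.lookup (e + point n (vertex (slice f ?M s) u)) i =
            Poly_Mapping.lookup ((1 - \<theta>) *\<^sub>R point ?M (vertex f w1) + \<theta> *\<^sub>R point ?M (vertex f w2)) i"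
        proof cases
          case 1
          then show ?thesis using vertex_insert[OF u'] \<theta>(3)
            by (simp add: lookup_add lookup_point lookup_scaleR e_def w1_def w2_def)
        next
          case 2
          have y: "y \<in> {1..n}" using u' by auto
          then have "y \<noteq> ?M" by auto
          have "f (insert ?M (insert y (set xs))) - s - f (set xs) = (1 - \<theta>) * (f (insert ?M (insert y (set xs))) - f (insert ?M (set xs)))
            + \<theta> * (f (insert y (set xs)) - f (set xs))"
            by (subst \<theta>(3)) (simp add: marginal_def algebra_simps)
          then show ?thesis using vertex_insert(3,4)[OF u', of f] vertex_slice(1)[OF Suc.prems(1) u' m] 2 y \<open>y \<noteq> ?M\<close>
            by (simp add: lookup_add lookup_point lookup_scaleR lookup_single e_def w1_def w2_def uxy when_def)
        next
          case 3
          then have "i \<noteq> ?M" by auto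
          have "vertex f w1 i = vertex (slice f ?M s) u i" "vertex f w2 i = vertex (slice f ?M s) u i"
            using vertex_slice(2,3)[OF Suc.prems(1) u' m 3] by (simp_all add: w1_def w2_def uxy)
          then show ?thesis using 3 \<open>i \<noteq> ?M\<close>
            by (simp add: lookup_add lookup_point lookup_scaleR lookup_single e_def when_def) (simp add: algebra_simps)
        next
          case 4
          then show ?thesis
            by (auto simp: lookup_add lookup_point lookup_scaleR lookup_single e_def when_def)
        qed
      qed
      also have "\<dots> \<in> ?H"
        using \<theta> w by (intro convexD[OF convex_convex_hull] hull_inc imageI) auto
      finally show "e + point n (vertex (slice f ?M s) u) \<in> ?H" .
    qed
  qed
  also have "e + point n t = point ?M t" by (simp add: e_def s_def point_def add.commute)
  finally show ?case .
qed

subsection \<open>Integration over sections\<close>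

abbreviation insert_at :: "'a list \<Rightarrow> 'a \<Rightarrow> nat \<Rightarrow> 'a list" where
  "insert_at u x p \<equiv> take p u @ x # drop p u"

definition vertex_sum :: "nat \<Rightarrow> (nat set \<Rightarrow> real) \<Rightarrow> real" where
  "vertex_sum n f = (\<Sum>u\<in>permutations_of_set {1..n}. \<Sum>a\<in>comps {1..n} (n - 1).
     desc_sign (\<lambda>x. int (a x)) 0 u * dpow {1..n} (vertex f u) a)"

text \<open>
  Between two consecutive breakpoints only coordinate \<open>y\<close> of the vertex of the section depends on
  \<open>s\<close>, with slope \<open>-1\<close>, so integration raises its exponent by one.
\<close>

lemma has_integral_vertex_piece:
  fixes \<kappa> :: "(nat \<Rightarrow> int) \<Rightarrow> real"
  assumes f: "submodular (Suc n) f"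
    and u: "set (xs @ y # ys) = {1..n}" "distinct (xs @ y # ys)"
  defines "M \<equiv> Suc n"
  shows "((\<lambda>s. \<Sum>b\<in>comps {1..n} k. \<kappa> (\<lambda>x. int (b x)) * dpow {1..n} (vertex (slice f M s) (xs @ y # ys)) b)
    has_integral (\<Sum>a\<in>comps {1..n} (Suc k). \<kappa> ((\<lambda>x. int (a x))(y := int (a y) - 1)) *
      (dpow {1..n} (vertex f (xs @ y # M # ys)) a - dpow {1..n} (vertex f (xs @ M # y # ys)) a)))
    {marginal f M (insert y (set xs))..marginal f M (set xs)}"
proof -
  let ?N = "{1..n}"
  let ?m1 = "marginal f M (insert y (set xs))" and ?m0 = "marginal f M (set xs)"
  let ?w1 = "xs @ M # y # ys" and ?w2 = "xs @ y # M # ys"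
  \<comment> \<open>\<open>A\<close> is the constant sum of the coordinates \<open>y\<close> and
    \<open>M\<close> along the edge, so that coordinate \<open>y\<close> of the section vertex is
    \<open>A - s\<close>.\<close>
  define A where "A = f (insert M (insert y (set xs))) - f (set xs)"
  define c where "c = (\<lambda>a. dpow (?N - {y}) (vertex f ?w1) a)"
  \<comment> \<open>The antiderivative; its sign compensates the slope -1 of \<open>A - s\<close>,
    and \<open>\<kappa>\<close> is taken at the exponents before they were raised at
    \<open>y\<close>.\<close>
  define G where "G = (\<lambda>s. - (\<Sum>a\<in>comps ?N (Suc k). \<kappa> ((\<lambda>x. int (a x))(y := int (a y) - 1)) * ((A - s) ^ a y / fact (a y) * c a)))"
  have y: "y \<in> ?N" unfolding u(1)[symmetric] by simp
  have sub: "insert y (set xs) \<subseteq> ?N" unfolding u(1)[symmetric] by auto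
  have m: "?m1 \<le> ?m0" unfolding M_def using marginal_antimono[OF f sub] by blast
  have w12: "vertex f ?w2 x = vertex f ?w1 x" if "x \<in> ?N" "x \<noteq> y" for x
    using vertex_slice(2,3)[OF f u, of ?m0 x] m that by (simp add: M_def)
  have slice: "dpow ?N (vertex (slice f M s) (xs @ y # ys)) b = (A - s) ^ b y / fact (b y) * c b" if "s \<in> {?m1..?m0}" for s b
  proof -
    have "vertex (slice f M s) (xs @ y # ys) y = A - s"
      using vertex_slice(1)[OF f u, of s] that by (simp add: M_def A_def)
    moreover have "dpow (?N - {y}) (vertex (slice f M s) (xs @ y # ys)) b = c b"
      unfolding c_def using vertex_slice(2)[OF f u, of s] that by (intro dpow_cong) (auto simp: M_def)
    ultimately show ?thesis using y by (simp add: dpow_remove[of _ y])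
  qed
  have pow: "((\<lambda>s. (A - s) ^ j / fact j) has_real_derivative (if j = 0 then 0 else - ((A - s) ^ (j - 1) / fact (j - 1)))) (at s within S)" for j s S
  proof (cases j)
    case (Suc i)
    have "((\<lambda>s. (A - s) ^ Suc i / fact (Suc i)) has_real_derivative (real (Suc i) * (A - s) ^ i * (-1) / fact (Suc i))) (at s within S)"
      by (auto intro!: derivative_eq_intros simp del: fact_Suc of_nat_Suc power_Suc)
    also have "real (Suc i) * (A - s) ^ i * (-1) / fact (Suc i) = - ((A - s) ^ i / fact i)"
      by (simp del: of_nat_Suc)
    finally show ?thesis using Suc by simp
  qed simp
  have "((\<lambda>s. \<Sum>b\<in>comps ?N k. \<kappa> (\<lambda>x. int (b x)) * dpow ?N (vertex (slice f M s) (xs @ y # ys)) b) has_integral (G ?m0 - G ?m1)) {?m1..?m0}"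
  proof (rule fundamental_theorem_of_calculus[OF m])
    fix s assume s: "s \<in> {?m1..?m0}"
    let ?d = "\<lambda>a. \<kappa> ((\<lambda>x. int (a x))(y := int (a y) - 1)) * ((if a y = 0 then 0 else - ((A - s) ^ (a y - 1) / fact (a y - 1))) * c a)"
    have "(G has_real_derivative - (\<Sum>a\<in>comps ?N (Suc k). ?d a)) (at s within {?m1..?m0})"
      unfolding G_def by (intro DERIV_minus DERIV_sum DERIV_cmult DERIV_cmult_right pow)
    also have "(\<Sum>a\<in>comps ?N (Suc k). ?d a) = (\<Sum>b\<in>comps ?N k. ?d (b(y := Suc (b y))))"
      using y by (intro sum_comps_Suc) auto
    also have "\<dots> = (\<Sum>b\<in>comps ?N k. - (\<kappa> (\<lambda>x. int (b x)) * dpow ?N (vertex (slice f M s) (xs @ y # ys)) b))"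
    proof (rule sum.cong[OF refl])
      fix b
      have "c (b(y := Suc (b y))) = c b" unfolding c_def by (intro dpow_cong) auto
      moreover have "(\<lambda>x. int ((b(y := Suc (b y))) x))(y := int ((b(y := Suc (b y))) y) - 1) = (\<lambda>x. int (b x))"
        by auto
      ultimately show "?d (b(y := Suc (b y))) = - (\<kappa> (\<lambda>x. int (b x)) * dpow ?N (vertex (slice f M s) (xs @ y # ys)) b)"
        unfolding slice[OF s] by (simp only: ) simp
    qed
    finally show "(G has_vector_derivative (\<Sum>b\<in>comps ?N k. \<kappa> (\<lambda>x. int (b x)) * dpow ?N (vertex (slice f M s) (xs @ y # ys)) b)) (at s within {?m1..?m0})"
      by (simp add: has_real_derivative_iff_has_vector_derivative sum_negf)
  qed
  also have "G ?m0 - G ?m1 = (\<Sum>a\<in>comps ?N (Suc k). \<kappa> ((\<lambda>x. int (a x))(y := int (a y) - 1)) *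
      (dpow ?N (vertex f ?w2) a - dpow ?N (vertex f ?w1) a))"
  proof -
    have "dpow ?N (vertex f ?w1) a = (A - ?m0) ^ a y / fact (a y) * c a" for a
    proof -
      have "vertex f ?w1 y = A - ?m0"
        using vertex_insert(3)[OF u, of f] by (simp add: M_def A_def marginal_def)
      then show ?thesis using y by (simp add: dpow_remove[of _ y] c_def)
    qed
    moreover have "dpow ?N (vertex f ?w2) a = (A - ?m1) ^ a y / fact (a y) * c a" for a
    proof -
      have "vertex f ?w2 y = A - ?m1"
        using vertex_insert(4)[OF u, of f] by (simp add: M_def A_def marginal_def)
      moreover have "dpow (?N - {y}) (vertex f ?w2) a = c a"
        unfolding c_def using w12 by (intro dpow_cong) auto
      ultimately show ?thesis using y by (simp add: dpow_remove[of _ y])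
    qed
    ultimately show ?thesis
      unfolding G_def by (simp add: right_diff_distrib sum_subtractf)
  qed
  finally show ?thesis .
qed

lemma has_integral_chain:
  fixes p :: "nat \<Rightarrow> real" and F :: "real \<Rightarrow> real"
  assumes "\<And>j. j < k \<Longrightarrow> p (Suc j) \<le> p j" "\<And>j. j < k \<Longrightarrow> (F has_integral I j) {p (Suc j)..p j}"
  shows "p k \<le> p 0 \<and> (F has_integral (\<Sum>j<k. I j)) {p k..p 0}"
  using assms
proof (induction k)
  case (Suc k)
  then have IH: "p k \<le> p 0" "(F has_integral (\<Sum>j<k. I j)) {p k..p 0}" by auto
  have "(F has_integral (I k + (\<Sum>j<k. I j))) {p (Suc k)..p 0}"
    using Suc.prems IH by (intro has_integral_combine[where c="p k"]) auto
  then show ?case using Suc.prems(1)[of k] IH(1) by (auto simp: add.commute)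
qed (auto simp: has_integral_refl)

text \<open>The boundary terms are absorbed by letting a coefficient outside the range count as 0;
  these conventions match insertion at the two ends of an ordering.\<close>

lemma abel_summation:
  fixes c T :: "nat \<Rightarrow> real"
  shows "(\<Sum>j<n. c j * (T (Suc j) - T j)) =
    (\<Sum>p\<le>n. ((if p = 0 then 0 else c (p - 1)) - (if p = n then 0 else c p)) * T p)"
proof -
  have "(\<Sum>p\<le>n. (if p = 0 then 0 else c (p - 1)) * T p) = (\<Sum>j<n. c j * T (Suc j))"
    by (subst sum.atMost_shift) simp
  moreover have "(\<Sum>p\<le>n. (if p = n then 0 else c p) * T p) = (\<Sum>j<n. c j * T j)"
    by (simp flip: lessThan_Suc_atMost)
  ultimately show ?thesis
    by (simp add: left_diff_distrib right_diff_distrib sum_subtractf)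
qed

text \<open>Insertion position \<open>p\<close> is the endpoint of two pieces of the path, on which
  the coordinates \<open>u ! (p - 1)\<close> and \<open>u ! p\<close> vary. Each contributes the old
  coefficient decremented at its moving coordinate, with opposite signs; at either end of
  \<open>u\<close> one piece is missing.\<close>

lemma desc_sign_insert_at:
  assumes u: "u \<in> permutations_of_set {1..n}" and n: "n \<ge> 1" and p: "p \<le> n" and a: "a \<in> comps {1..n} n"
  defines "c \<equiv> \<lambda>y. desc_sign ((\<lambda>x. int (a x))(y := int (a y) - 1)) 0 u"
  shows "(if p = 0 then 0 else c (u ! (p - 1))) - (if p = n then 0 else c (u ! p)) =
    desc_sign (\<lambda>x. int (a x)) 0 (insert_at u (Suc n) p)"
proof -
  have d: "distinct u" "set u = {1..n}" using u by (auto dest: permutations_of_setD)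
  then have len: "length u = n" using distinct_card[of u] by simp
  have less: "x < Suc n" if "x \<in> set u" for x using that d by auto
  have aM: "int (a (Suc n)) = 0" using a by (simp add: comps_def)
  have "sum_list (map (\<lambda>x. int (a x)) u) = int (sum a (set u))"
    using d by (simp add: sum_list_distinct_conv_sum_set)
  also have "\<dots> = int (length u)" using a len unfolding d(2) by (simp add: comps_def)
  finally have tot: "sum_list (map (\<lambda>x. int (a x)) u) = int (length u)" .
  consider "p = 0" | "p = n" "p > 0" | q where "p = Suc q" "p < n"
    using p not0_implies_Suc[of p] by fastforce
  then show ?thesis
  proof cases
    case 1
    then obtain y ys where u': "u = y # ys" using len n by (cases u) auto
    have y: "y < Suc n" using less[of y] by (simp add: u')
    have dy: "distinct (y # ys)" using d(1) unfolding u' .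
    have "desc_sign (\<lambda>x. int (a x)) 0 (Suc n # y # ys) = - c y"
      unfolding c_def u' by (rule desc_sign_insert_front[of y ys "Suc n" "\<lambda>x. int (a x)", OF dy y aM])
    then show ?thesis using 1 n by (simp add: u' del: desc_sign.simps)
  next
    case 2
    then obtain xs z where u': "u = xs @ [z]" using len n by (cases u rule: rev_cases) auto
    have "length xs = n - 1" using u' len by auto
    then show ?thesis using 2 desc_sign_insert_back[of xs z "Suc n" "\<lambda>x. int (a x)"] d less[of z] tot len
      by (simp add: u' c_def nth_append)
  next
    case 3
    define xs where "xs = take q u"
    define z where "z = u ! q"
    define y where "y = u ! p"
    define ys where "ys = drop (Suc p) u"
    have dr: "drop p u = y # ys" unfolding y_def ys_def using 3 len by (simp add: Cons_nth_drop_Suc)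
    have tk: "take p u = xs @ [z]" unfolding xs_def z_def using 3 len by (simp add: take_Suc_conv_app_nth)
    have u': "u = xs @ z # y # ys" using append_take_drop_id[of p u] unfolding tk dr by simp
    have "desc_sign (\<lambda>x. int (a x)) 0 (xs @ z # Suc n # y # ys) = c z - c y"
      unfolding c_def u'
      by (rule desc_sign_insert_mid[of xs z y ys "Suc n" "\<lambda>x. int (a x)", OF d(1)[unfolded u'] less[unfolded u'] aM])
    then show ?thesis using 3 unfolding tk dr by (simp add: z_def y_def)
  qed
qed

text \<open>Integration produces monomials without the new coordinate, whereas
  \<open>vertex_sum\<close> ranges over all exponent vectors of degree \<open>n\<close>. Those with
  a positive exponent at \<open>Suc n\<close> have coefficient 0.\<close>

lemma sum_comps_insert_max:
  fixes p :: nat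
  assumes u: "u \<in> permutations_of_set {1..n}" and n: "n \<ge> 1"
  defines "w \<equiv> insert_at u (Suc n) p"
  shows "(\<Sum>a\<in>comps {1..n} n. desc_sign (\<lambda>x. int (a x)) 0 w * dpow {1..n} v a) =
    (\<Sum>a\<in>comps {1..Suc n} n. desc_sign (\<lambda>x. int (a x)) 0 w * dpow {1..Suc n} v a)"
proof -
  have d: "distinct u" "set u = {1..n}" using u by (auto dest: permutations_of_setD)
  have len: "length u = n" using distinct_card[OF d(1)] d(2) by simp
  have N: "{1..Suc n} = insert (Suc n) {1..n}" by auto
  have "(\<Sum>a\<in>comps {1..n} n. desc_sign (\<lambda>x. int (a x)) 0 w * dpow {1..n} v a) =
    (\<Sum>a\<in>comps {1..n} n. desc_sign (\<lambda>x. int (a x)) 0 w * dpow {1..Suc n} v a)"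
    unfolding N by (intro sum.cong refl) (simp add: comps_def dpow_def)
  also have "\<dots> = (\<Sum>a\<in>comps {1..Suc n} n. desc_sign (\<lambda>x. int (a x)) 0 w * dpow {1..Suc n} v a)"
  proof (rule sum.mono_neutral_left)
    show "comps {1..n} n \<subseteq> comps {1..Suc n} n" unfolding N by (auto simp: comps_def)
    show "\<forall>a\<in>comps {1..Suc n} n - comps {1..n} n. desc_sign (\<lambda>x. int (a x)) 0 w * dpow {1..Suc n} v a = 0"
    proof
      fix a assume a: "a \<in> comps {1..Suc n} n - comps {1..n} n"
      then have a': "\<And>x. x \<notin> insert (Suc n) {1..n} \<Longrightarrow> a x = 0" "a (Suc n) + sum a {1..n} = n"
        unfolding N by (auto simp: comps_def)
      have pos: "a (Suc n) > 0"
      proof (rule ccontr)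
        assume "\<not> a (Suc n) > 0"
        then have "a (Suc n) = 0" by simp
        then have "a x = 0" if "x \<notin> {1..n}" for x
          using a'(1)[of x] that by (cases "x = Suc n") auto
        then have "a \<in> comps {1..n} n"
          using a'(2) \<open>a (Suc n) = 0\<close> by (simp add: comps_def)
        then show False using a by blast
      qed
      have un: "take p u @ drop p u = u" by simp
      have "sum_list (map (\<lambda>x. int (a x)) w) = int (a (Suc n)) + sum_list (map (\<lambda>x. int (a x)) (take p u @ drop p u))"
        unfolding w_def map_append sum_list_append list.map sum_list.Cons by (simp only: ac_simps)
      also have "\<dots> = int (a (Suc n)) + int (sum a (set u))"
        unfolding un using d(1) by (simp add: sum_list_distinct_conv_sum_set)
      also have "\<dots> = int (length (take p u @ drop p u))"
        unfolding un d(2) len using a'(2) by linarith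
      finally have tot: "sum_list (map (\<lambda>x. int (a x)) (take p u @ Suc n # drop p u)) = int (length (take p u @ drop p u))"
        unfolding w_def .
      have "desc_sign (\<lambda>x. int (a x)) 0 w = 0"
        unfolding w_def
      proof (rule desc_sign_max_zero[of _ _ "Suc n" "\<lambda>x. int (a x)", OF _ _ _ tot])
        show "x < Suc n" if "x \<in> set (take p u @ drop p u)" for x
          using that unfolding un d(2) by simp
        show "0 < int (a (Suc n))" using pos by simp
        show "take p u @ drop p u \<noteq> []" unfolding un using len n by auto
      qed
      then show "desc_sign (\<lambda>x. int (a x)) 0 w * dpow {1..Suc n} v a = 0" by simp
    qed
  qed simp
  finally show ?thesis .
qed

lemma sum_permutations_insert:
  fixes g :: "nat list \<Rightarrow> real"
  shows "(\<Sum>u\<in>permutations_of_set {1..n}. \<Sum>p\<le>n. g (insert_at u (Suc n) p)) =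
    (\<Sum>w\<in>permutations_of_set {1..Suc n}. g w)"
proof -
  have N: "{1..Suc n} = insert (Suc n) {1..n}" by auto
  let ?i = "\<lambda>w. (filter (\<lambda>z. z \<noteq> Suc n) w, length (takeWhile (\<lambda>z. z \<noteq> Suc n) w))"
  have "(\<Sum>u\<in>permutations_of_set {1..n}. \<Sum>p\<le>n. g (insert_at u (Suc n) p)) =
     (\<Sum>(u,p)\<in>permutations_of_set {1..n} \<times> {..n}. g (insert_at u (Suc n) p))"
    by (simp add: sum.cartesian_product)
  also have "\<dots> = (\<Sum>w\<in>permutations_of_set {1..Suc n}. g w)"
  proof (rule sum.reindex_bij_witness[of _ ?i "\<lambda>(u, p). insert_at u (Suc n) p"])
    fix w assume w: "w \<in> permutations_of_set {1..Suc n}"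
    then have "Suc n \<in> set w" and dw: "distinct w" "set w = {1..Suc n}" by (auto dest: permutations_of_setD)
    then obtain xs ys where w': "w = xs @ Suc n # ys" by (meson split_list)
    have nm: "Suc n \<notin> set xs" "Suc n \<notin> set ys" using dw w' by auto
    then have fl: "filter (\<lambda>z. z \<noteq> Suc n) xs = xs" "filter (\<lambda>z. z \<noteq> Suc n) ys = ys"
      by (auto simp: filter_id_conv)
    then have i: "?i w = (xs @ ys, length xs)" using nm by (simp add: w' takeWhile_neq_mid)
    then show "(\<lambda>(u, p). insert_at u (Suc n) p) (?i w) = w" by (simp add: w')
    have "insert (Suc n) (set (xs @ ys)) = insert (Suc n) {1..n}" using dw(2) unfolding w' N by simp
    then have "set (xs @ ys) = {1..n}"
      by (subst (asm) insert_ident) (use nm in auto)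
    moreover have "distinct (xs @ ys)" using dw unfolding w' by auto
    ultimately have "length (xs @ ys) = n" using distinct_card[of "xs @ ys"] by simp
    then show "?i w \<in> permutations_of_set {1..n} \<times> {..n}"
      unfolding i using \<open>set (xs @ ys) = {1..n}\<close> \<open>distinct (xs @ ys)\<close> by (auto simp: permutations_of_set_def)
  next
    fix z assume z: "z \<in> permutations_of_set {1..n} \<times> {..n}"
    obtain u p where up: "z = (u, p)" by force
    have d: "distinct u" "set u = {1..n}" using z up by (auto dest: permutations_of_setD)
    then have len: "length u = n" using distinct_card[of u] by simp
    have "Suc n \<notin> set u" using d by auto
    then have nm: "Suc n \<notin> set (take p u)" "Suc n \<notin> set (drop p u)" by (auto dest: in_set_takeD in_set_dropD)
    then have fl: "filter (\<lambda>z. z \<noteq> Suc n) (take p u) = take p u" "filter (\<lambda>z. z \<noteq> Suc n) (drop p u) = drop p u"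
      by (auto simp: filter_id_conv)
    show "?i ((\<lambda>(u, p). insert_at u (Suc n) p) z) = z"
      using nm z len by (simp add: up takeWhile_neq_mid fl)
    obtain xs ys where xy: "take p u = xs" "drop p u = ys" by blast
    then have "u = xs @ ys" using append_take_drop_id[of p u] by simp
    then have "set xs \<union> set ys = {1..n}" "distinct (xs @ ys)" using d by auto
    then show "(\<lambda>(u, p). insert_at u (Suc n) p) z \<in> permutations_of_set {1..Suc n}"
      using nm unfolding up permutations_of_set_def N xy by (auto simp: xy)
  qed auto
  finally show ?thesis .
qed

lemma has_integral_vertex_sum:
  assumes f: "submodular (Suc n) f" and n: "n \<ge> 1"
  shows "((\<lambda>s. vertex_sum n (slice f (Suc n) s)) has_integral vertex_sum (Suc n) f)
    {marginal f (Suc n) {1..n}..marginal f (Suc n) {}}"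
proof -
  let ?M = "Suc n" and ?N = "{1..n}"
  let ?J = "{marginal f (Suc n) {1..n}..marginal f (Suc n) {}}"
  define K where "K = (\<lambda>a u. desc_sign (\<lambda>x. int (a x)) 0 u)"
  have *: "((\<lambda>s. \<Sum>a\<in>comps ?N (n - 1). K a u * dpow ?N (vertex (slice f ?M s) u) a) has_integral
      (\<Sum>p\<le>n. \<Sum>a\<in>comps {1..Suc n} n. K a (insert_at u ?M p) * dpow {1..Suc n} (vertex f (insert_at u ?M p)) a)) ?J"
    if u: "u \<in> permutations_of_set {1..n}" for u
  proof -
    have d: "distinct u" "set u = {1..n}" using u by (auto dest: permutations_of_setD)
    then have len: "length u = n" using distinct_card[of u] by simp
    define c where "c = (\<lambda>a y. desc_sign ((\<lambda>x. int (a x))(y := int (a y) - 1)) 0 u)"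
    define T where "T = (\<lambda>p a. dpow ?N (vertex f (insert_at u ?M p)) a)"
    define p where "p = (\<lambda>j. marginal f ?M (set (take j u)))"
    define I where "I = (\<lambda>j. \<Sum>a\<in>comps ?N n. c a (u ! j) * (T (Suc j) a - T j a))"
    have 1: "p (Suc j) \<le> p j" if "j < n" for j
      unfolding p_def
    proof (rule marginal_antimono[OF f])
      show "set (take (Suc j) u) \<subseteq> {1..n}" using d(2) by (auto dest: in_set_takeD)
      show "set (take j u) \<subseteq> set (take (Suc j) u)" by (simp add: set_take_subset_set_take)
    qed
    have 2: "((\<lambda>s. \<Sum>a\<in>comps ?N (n - 1). K a u * dpow ?N (vertex (slice f ?M s) u) a) has_integral I j) {p (Suc j)..p j}" if "j < n" for j
    proof -
      define xs where "xs = take j u"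
      define y where "y = u ! j"
      define ys where "ys = drop (Suc j) u"
      have dr: "drop j u = y # ys" unfolding y_def ys_def using that len by (simp add: Cons_nth_drop_Suc)
      have tk: "take (Suc j) u = xs @ [y]" unfolding xs_def y_def using that len by (simp add: take_Suc_conv_app_nth)
      have u': "u = xs @ y # ys" using append_take_drop_id[of j u] dr unfolding xs_def by simp
      have "T j = (\<lambda>a. dpow ?N (vertex f (xs @ ?M # y # ys)) a)" "T (Suc j) = (\<lambda>a. dpow ?N (vertex f (xs @ y # ?M # ys)) a)"
        unfolding T_def dr tk by (simp_all add: xs_def ys_def)
      moreover have "p j = marginal f ?M (set xs)" "p (Suc j) = marginal f ?M (insert y (set xs))"
        unfolding p_def tk by (simp_all add: xs_def)
      ultimately show ?thesis
        using has_integral_vertex_piece[OF f d(2,1)[unfolded u'], of "\<lambda>a. desc_sign a 0 u" "n - 1"] n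
        unfolding I_def c_def K_def u'[symmetric] y_def[symmetric] by simp
    qed
    have int: "((\<lambda>s. \<Sum>a\<in>comps ?N (n - 1). K a u * dpow ?N (vertex (slice f ?M s) u) a) has_integral (\<Sum>j<n. I j)) {p n..p 0}"
      using has_integral_chain[of n p _ I, OF 1 2] by blast
    \<comment> \<open>The extreme breakpoints belong to the full and the empty prefix and are the
      same for every \<open>u\<close>, so the integrals for different orderings can be
      added.\<close>
    have J: "{p n..p 0} = ?J" by (simp add: p_def len d)
    have "(\<Sum>j<n. I j) = (\<Sum>a\<in>comps ?N n. \<Sum>j<n. c a (u ! j) * (T (Suc j) a - T j a))"
      unfolding I_def by (rule sum.swap)
    also have "\<dots> = (\<Sum>a\<in>comps ?N n. \<Sum>p\<le>n. K a (insert_at u ?M p) * T p a)"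
    proof (rule sum.cong[OF refl])
      fix a assume a: "a \<in> comps ?N n"
      show "(\<Sum>j<n. c a (u ! j) * (T (Suc j) a - T j a)) = (\<Sum>p\<le>n. K a (insert_at u ?M p) * T p a)"
        unfolding abel_summation[of "\<lambda>j. c a (u ! j)" "\<lambda>j. T j a"]
        unfolding c_def K_def
        by (intro sum.cong refl arg_cong2[where f="(*)"] desc_sign_insert_at[OF u n _ a]) simp
    qed
    also have "\<dots> = (\<Sum>p\<le>n. \<Sum>a\<in>comps ?N n. K a (insert_at u ?M p) * T p a)"
      by (rule sum.swap)
    also have "\<dots> = (\<Sum>p\<le>n. \<Sum>a\<in>comps {1..Suc n} n. K a (insert_at u ?M p) * dpow {1..Suc n} (vertex f (insert_at u ?M p)) a)"
      unfolding T_def K_def by (intro sum.cong refl sum_comps_insert_max u n)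
    finally show ?thesis using int unfolding J by simp
  qed
  have "((\<lambda>s. \<Sum>u\<in>permutations_of_set ?N. \<Sum>a\<in>comps ?N (n - 1). K a u * dpow ?N (vertex (slice f ?M s) u) a) has_integral
      (\<Sum>u\<in>permutations_of_set ?N. \<Sum>p\<le>n. \<Sum>a\<in>comps {1..Suc n} n. K a (insert_at u ?M p) * dpow {1..Suc n} (vertex f (insert_at u ?M p)) a)) ?J"
    by (intro has_integral_sum * ) auto
  also have "(\<Sum>u\<in>permutations_of_set ?N. \<Sum>p\<le>n. \<Sum>a\<in>comps {1..Suc n} n. K a (insert_at u ?M p) * dpow {1..Suc n} (vertex f (insert_at u ?M p)) a) = vertex_sum (Suc n) f"
    unfolding vertex_sum_def sum_permutations_insert[of "\<lambda>w. \<Sum>a\<in>comps {1..Suc n} n. K a w * dpow {1..Suc n} (vertex f w) a"]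
    by (simp add: K_def)
  finally show ?thesis unfolding vertex_sum_def K_def .
qed

subsection \<open>Volumes of base polytopes\<close>

text \<open>The projection of the base polytope that forgets coordinate \<open>r\<close>.\<close>

definition region :: "nat \<Rightarrow> (nat set \<Rightarrow> real) \<Rightarrow> nat \<Rightarrow> (nat \<Rightarrow> real) set" where
  "region n f r = {x\<in>space (Pi\<^sub>M ({1..n} - {r}) (\<lambda>_. lborel)).
     x(r := f {1..n} - sum x ({1..n} - {r})) \<in> base_polytope n f}"

interpretation lborel_product: product_sigma_finite "\<lambda>_::nat. lborel :: real measure"
  by standard

lemma sets_region [measurable]: "region n f r \<in> sets (Pi\<^sub>M ({1..n} - {r}) (\<lambda>_. lborel))"
proof -
  let ?P = "Pi\<^sub>M ({1..n} - {r}) (\<lambda>_. lborel :: real measure)"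
  let ?e = "\<lambda>x. x(r := f {1..n} - sum x ({1..n} - {r}))"
  have comp: "(\<lambda>x. x i) \<in> borel_measurable ?P" if "i \<in> {1..n} - {r}" for i
    using measurable_component_singleton[OF that, of "\<lambda>_. lborel :: real measure"] by simp
  have "(\<lambda>x. ?e x i) \<in> borel_measurable ?P" if "i \<in> {1..n}" for i
    using that comp[of i] by (cases "i = r") (auto intro!: borel_measurable_diff borel_measurable_sum comp)
  then have m: "(\<lambda>x. sum (?e x) S) \<in> borel_measurable ?P" if "S \<subseteq> {1..n}" for S
    using that by (intro borel_measurable_sum) auto
  have [measurable]: "(\<lambda>x. sum (?e x) {1..n}) \<in> borel_measurable ?P" by (rule m) simp
  have "{x \<in> space ?P. sum (?e x) S \<le> f S} \<in> sets ?P" if "S \<subseteq> {1..n}" for S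
    using m[OF that] by measurable
  then have "{x \<in> space ?P. \<forall>S\<in>Pow {1..n}. sum (?e x) S \<le> f S} \<in> sets ?P"
    by (intro sets.sets_Collect_finite_All) auto
  moreover have "{x \<in> space ?P. sum (?e x) {1..n} = f {1..n}} \<in> sets ?P"
    by measurable
  ultimately have "{x \<in> space ?P. sum (?e x) {1..n} = f {1..n}} \<inter> {x \<in> space ?P. \<forall>S\<in>Pow {1..n}. sum (?e x) S \<le> f S} \<in> sets ?P"
    by (rule sets.Int[rotated])
  moreover have "region n f r = {x \<in> space ?P. sum (?e x) {1..n} = f {1..n}} \<inter> {x \<in> space ?P. \<forall>S\<in>Pow {1..n}. sum (?e x) S \<le> f S}"
    unfolding region_def base_polytope_def by blast
  ultimately show ?thesis by metis
qed

text \<open>With the other coordinates fixed, those at \<open>r\<close> and \<open>q\<close> have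
  the constant sum \<open>c x\<close>. Trading one for the other is the reflection of the line
  sending \<open>y\<close> to \<open>c x - y\<close>, which preserves Lebesgue measure.\<close>

lemma emeasure_region_swap:
  assumes rq: "r \<in> {1..n}" "q \<in> {1..n}"
  shows "emeasure (Pi\<^sub>M ({1..n} - {r}) (\<lambda>_. lborel)) (region n f r) =
    emeasure (Pi\<^sub>M ({1..n} - {q}) (\<lambda>_. lborel)) (region n f q)"
proof (cases "r = q")
  case False
  define I where "I = {1..n} - {r, q}"
  have I: "finite I" "q \<notin> I" "r \<notin> I" by (auto simp: I_def)
  have ins: "{1..n} - {r} = insert q I" "{1..n} - {q} = insert r I"
    using rq False by (auto simp: I_def)
  let ?P = "Pi\<^sub>M I (\<lambda>_. lborel :: real measure)"
  define c where "c = (\<lambda>x. f {1..n} - sum x I)"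
  have *: "emeasure (Pi\<^sub>M (insert a I) (\<lambda>_. lborel)) (region n f b) =
      (\<integral>\<^sup>+ x. (\<integral>\<^sup>+ y. indicator (base_polytope n f) (x(a := y, b := c x - y)) \<partial>lborel) \<partial>?P)"
    if "{1..n} - {b} = insert a I" "a \<notin> I" for a b
  proof -
    have [measurable]: "region n f b \<in> sets (Pi\<^sub>M (insert a I) (\<lambda>_. lborel))"
      using sets_region[of n f b] unfolding that(1) .
    have "emeasure (Pi\<^sub>M (insert a I) (\<lambda>_. lborel)) (region n f b) =
       (\<integral>\<^sup>+ x. indicator (region n f b) x \<partial>Pi\<^sub>M (insert a I) (\<lambda>_. lborel))"
      by simp
    also have "\<dots> = (\<integral>\<^sup>+ x. (\<integral>\<^sup>+ y. indicator (region n f b) (x(a := y)) \<partial>lborel) \<partial>?P)"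
      using I that by (intro lborel_product.product_nn_integral_insert) auto
    also have "\<dots> = (\<integral>\<^sup>+ x. (\<integral>\<^sup>+ y. indicator (base_polytope n f) (x(a := y, b := c x - y)) \<partial>lborel) \<partial>?P)"
    proof (intro nn_integral_cong)
      fix x :: "nat \<Rightarrow> real" and y :: real
      assume x: "x \<in> space ?P"
      then have "x(a := y) \<in> space (Pi\<^sub>M (insert a I) (\<lambda>_. lborel))"
        by (auto simp: space_PiM PiE_def extensional_def)
      moreover have "sum (x(a := y)) (insert a I) = y + sum x I"
        using I that(2) by (auto intro!: sum.cong)
      ultimately show "indicator (region n f b) (x(a := y)) = (indicator (base_polytope n f) (x(a := y, b := c x - y)) :: ennreal)"
        unfolding region_def that(1) by (simp add: indicator_def c_def algebra_simps)
    qed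
    finally show ?thesis .
  qed
  have "(\<integral>\<^sup>+ y. indicator (base_polytope n f) (x(q := y, r := c x - y)) \<partial>lborel) =
      (\<integral>\<^sup>+ z. indicator (base_polytope n f) (x(r := z, q := c x - z)) \<partial>lborel)" (is "(\<integral>\<^sup>+ y. ?g y \<partial>_) = _") for x
  proof -
    have e: "(\<lambda>y. (x(q := y, r := c x - y)) i) \<in> borel_measurable borel" for i
      by (cases "i = r"; cases "i = q") auto
    have [measurable]: "(\<lambda>y. sum (x(q := y, r := c x - y)) S) \<in> borel_measurable borel" for S
      by (intro borel_measurable_sum e)
    have "{y. x(q := y, r := c x - y) \<in> base_polytope n f} =
        {y. sum (x(q := y, r := c x - y)) {1..n} = f {1..n}} \<inter> (\<Inter>S\<in>Pow {1..n}. {y. sum (x(q := y, r := c x - y)) S \<le> f S})"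
      by (auto simp: base_polytope_def)
    also have "\<dots> \<in> sets borel"
    proof (intro sets.Int sets.finite_INT)
      show "{y. sum (x(q := y, r := c x - y)) {1..n} = f {1..n}} \<in> sets borel" by measurable
      show "{y. sum (x(q := y, r := c x - y)) S \<le> f S} \<in> sets borel" for S by measurable
    qed auto
    finally have [measurable]: "{y. x(q := y, r := c x - y) \<in> base_polytope n f} \<in> sets borel" .
    have "?g = indicator {y. x(q := y, r := c x - y) \<in> base_polytope n f}"
      by (auto simp: fun_eq_iff indicator_def)
    then have "?g \<in> borel_measurable borel" by simp
    have tw: "x(q := c x + - 1 * z, r := c x - (c x + - 1 * z)) = x(r := z, q := c x - z)" for z
      using False by (auto simp: fun_eq_iff)
    from \<open>?g \<in> borel_measurable borel\<close>
    have "(\<integral>\<^sup>+ y. ?g y \<partial>lborel) = \<bar>- 1 :: real\<bar> * (\<integral>\<^sup>+ z. ?g (c x + (- 1) * z) \<partial>lborel)"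
      by (intro nn_integral_real_affine) auto
    also have "\<dots> = (\<integral>\<^sup>+ z. indicator (base_polytope n f) (x(r := z, q := c x - z)) \<partial>lborel)"
      unfolding tw by simp
    finally show ?thesis .
  qed
  then show ?thesis
    using *[OF ins(1) I(2)] *[OF ins(2) I(3)] unfolding ins by simp
qed simp

text \<open>Coordinate 1 is the eliminated one throughout, so the section coordinate
  \<open>Suc n\<close> is always available as the outer variable of Fubini. Nonnegativity is carried
  along because \<open>ennreal\<close> truncates negative values.\<close>

lemma emeasure_region:
  assumes "n \<ge> 1" "submodular n f"
  shows "emeasure (Pi\<^sub>M ({1..n} - {1}) (\<lambda>_. lborel)) (region n f 1) = ennreal (vertex_sum n f) \<and> 0 \<le> vertex_sum n f"
  using assms
proof (induction n arbitrary: f rule: nat_induct_at_least)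
  case base
  have "x(1 := f {1}) \<in> base_polytope 1 f" for x :: "nat \<Rightarrow> real"
  proof -
    have "sum (x(1 := f {1})) S \<le> f S" if "S \<subseteq> {1}" for S
      using base that by (cases "S = {}") (auto simp: submodular_def subset_singleton_iff)
    then show ?thesis by (simp add: base_polytope_def)
  qed
  \<comment> \<open>No coordinate is left: the region is the single point of the empty product, of
    measure 1, and the only monomial is constant.\<close>
  then have "region 1 f 1 = {\<lambda>_. undefined}"
    by (auto simp: region_def space_PiM_empty)
  moreover have "comps {1::nat} 0 = {\<lambda>_. 0}" by (rule comps_0) simp
  ultimately show ?case by (simp add: vertex_sum_def dpow_def)
next
  case (Suc n)
  let ?M = "Suc n" and ?I = "{1..n} - {1}"
  let ?J = "{marginal f ?M {1..n}..marginal f ?M {}}"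
  have n: "n \<ge> 1" by fact
  have hi: "marginal f ?M {} = f {?M}" using Suc.prems by (simp add: marginal_def submodular_def)
  have ins: "{1..?M} - {1} = insert ?M ?I" using n by auto
  have M: "?M \<notin> ?I" "?M \<noteq> 1" using n by auto
  have IH: "emeasure (Pi\<^sub>M ?I (\<lambda>_. lborel)) (region n (slice f ?M s) 1) = ennreal (vertex_sum n (slice f ?M s))"
    "0 \<le> vertex_sum n (slice f ?M s)" if "s \<in> ?J" for s
    using Suc.IH[OF submodular_slice[OF Suc.prems, of s]] that hi by auto
  have reg: "region ?M f 1 \<in> sets (Pi\<^sub>M (insert ?M ?I) (\<lambda>_. lborel))"
    using sets_region[of ?M f 1] unfolding ins .
  have "emeasure (Pi\<^sub>M ({1..?M} - {1}) (\<lambda>_. lborel)) (region ?M f 1) =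
      (\<integral>\<^sup>+ x. indicator (region ?M f 1) x \<partial>Pi\<^sub>M (insert ?M ?I) (\<lambda>_. lborel))"
    unfolding ins by (rule nn_integral_indicator[OF reg, symmetric])
  also have "\<dots> = (\<integral>\<^sup>+ s. (\<integral>\<^sup>+ x. indicator (region ?M f 1) (x(?M := s)) \<partial>Pi\<^sub>M ?I (\<lambda>_. lborel)) \<partial>lborel)"
    using M by (intro lborel_product.product_nn_integral_insert_rev borel_measurable_indicator reg) auto
  also have "\<dots> = (\<integral>\<^sup>+ s. ennreal (vertex_sum n (slice f ?M s)) * indicator ?J s \<partial>lborel)"
  proof (intro nn_integral_cong)
    fix s :: real
    have *: "indicator (region ?M f 1) (x(?M := s)) = indicator ?J s * (indicator (region n (slice f ?M s) 1) x :: ennreal)"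
      if x: "x \<in> space (Pi\<^sub>M ?I (\<lambda>_. lborel))" for x
    proof -
      have sp: "x(?M := s) \<in> space (Pi\<^sub>M (insert ?M ?I) (\<lambda>_. lborel))"
        using x by (auto simp: space_PiM PiE_def extensional_def)
      have "sum (x(?M := s)) (insert ?M ?I) = s + sum (x(?M := s)) ?I"
        using M by (subst sum.insert) auto
      also have "sum (x(?M := s)) ?I = sum x ?I"
        using M by (intro sum.cong) auto
      finally have sm: "sum (x(?M := s)) (insert ?M ?I) = s + sum x ?I" .
      define t where "t = x(?M := s, 1 := f {1..?M} - (s + sum x ?I))"
      have tM: "t ?M = s" using M by (simp add: t_def)
      have "x(?M := s) \<in> region ?M f 1 \<longleftrightarrow> t \<in> base_polytope ?M f"
        unfolding region_def ins t_def using sp sm by simp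
      also have "\<dots> \<longleftrightarrow> s \<in> ?J \<and> t \<in> base_polytope n (slice f ?M s)"
        unfolding base_polytope_slice[OF Suc.prems] tM hi by simp
      also have "\<dots> \<longleftrightarrow> s \<in> ?J \<and> x \<in> region n (slice f ?M s) 1"
      proof (rule conj_cong[OF refl])
        assume s: "s \<in> ?J"
        \<comment> \<open>For \<open>s\<close> in \<open>?J\<close> the full set lies on the high
          branch of \<open>slice\<close>, so solving for coordinate 1 gives the same value in the
          section as in the whole polytope.\<close>
        have "{1..?M} = insert ?M {1..n}" by auto
        then have "slice f ?M s {1..n} = f {1..?M} - s"
          using s by (simp add: slice_high)
        then have "t i = (x(1 := slice f ?M s {1..n} - sum x ?I)) i" if "i \<in> {1..n}" for i
          using that by (auto simp: t_def)
        then show "t \<in> base_polytope n (slice f ?M s) \<longleftrightarrow> x \<in> region n (slice f ?M s) 1"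
          unfolding region_def using x base_polytope_cong[of n t "x(1 := slice f ?M s {1..n} - sum x ?I)"] by simp
      qed
      finally show ?thesis by (auto simp: indicator_def)
    qed
    have "(\<integral>\<^sup>+ x. indicator (region ?M f 1) (x(?M := s)) \<partial>Pi\<^sub>M ?I (\<lambda>_. lborel)) =
        (\<integral>\<^sup>+ x. indicator ?J s * indicator (region n (slice f ?M s) 1) x \<partial>Pi\<^sub>M ?I (\<lambda>_. lborel))"
      by (rule nn_integral_cong) (rule *)
    also have "\<dots> = indicator ?J s * emeasure (Pi\<^sub>M ?I (\<lambda>_. lborel)) (region n (slice f ?M s) 1)"
      using sets_region by (subst nn_integral_cmult) auto
    also have "\<dots> = ennreal (vertex_sum n (slice f ?M s)) * indicator ?J s"
      using IH(1)[of s] by (auto simp: indicator_def)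
    finally show "(\<integral>\<^sup>+ x. indicator (region ?M f 1) (x(?M := s)) \<partial>Pi\<^sub>M ?I (\<lambda>_. lborel)) =
       ennreal (vertex_sum n (slice f ?M s)) * indicator ?J s" .
  qed
  also have "\<dots> = ennreal (vertex_sum ?M f)"
    using IH(2) has_integral_vertex_sum[OF Suc.prems n] by (intro nn_integral_has_integral_lebesgue') auto
  finally show ?case
    using has_integral_nonneg[OF has_integral_vertex_sum[OF Suc.prems n]] IH(2) by blast
qed

subsection \<open>Generalized permutohedra\<close>

text \<open>For nonnegative \<open>y\<close> this is the maximum over the Minkowski sum of the sum
  of the coordinates in \<open>S\<close>: a simplex \<open>I\<close> reaches 1 there if it meets
  \<open>S\<close>, and only 0 otherwise.\<close>

definition coverage :: "nat \<Rightarrow> (nat set \<Rightarrow> real) \<Rightarrow> nat set \<Rightarrow> real" where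
  "coverage n y S = (\<Sum>I | I \<subseteq> {1..n} \<and> I \<inter> S \<noteq> {}. y I)"

lemma coverage_altdef: "coverage n y S = (\<Sum>I\<in>Pow {1..n} - {{}}. if I \<inter> S \<noteq> {} then y I else 0)"
proof -
  have "{I. I \<subseteq> {1..n} \<and> I \<inter> S \<noteq> {}} = {I\<in>Pow {1..n} - {{}}. I \<inter> S \<noteq> {}}" by blast
  then show ?thesis unfolding coverage_def by (simp only:) (rule sum.inter_filter, simp)
qed

lemma submodular_coverage:
  assumes "\<And>I. I \<subseteq> {1..n} \<Longrightarrow> I \<noteq> {} \<Longrightarrow> y I \<ge> 0"
  shows "submodular n (coverage n y)"
  unfolding submodular_def
proof (intro conjI allI impI)
  show "coverage n y {} = 0" by (simp add: coverage_def)
  show "coverage n y (X \<union> Y) + coverage n y (X \<inter> Y) \<le> coverage n y X + coverage n y Y" for X Y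
    unfolding coverage_altdef sum.distrib[symmetric]
  proof (rule sum_mono)
    fix I assume "I \<in> Pow {1..n} - {{}}"
    then have "y I \<ge> 0" using assms by auto
    then show "(if I \<inter> (X \<union> Y) \<noteq> {} then y I else 0) + (if I \<inter> (X \<inter> Y) \<noteq> {} then y I else 0)
      \<le> (if I \<inter> X \<noteq> {} then y I else 0) + (if I \<inter> Y \<noteq> {} then y I else 0)"
      by auto
  qed
qed

text \<open>The marginal of \<open>x\<close> collects the sets hit for the first time at
  \<open>x\<close>, namely those containing \<open>x\<close> but none of its predecessors in
  \<open>u\<close>.\<close>

lemma vertex_coverage:
  "vertex (coverage n y) u x =
    (\<Sum>I\<in>{I\<in>Pow {1..n} - {{}}. x \<in> I \<and> I \<inter> set (takeWhile (\<lambda>z. z \<noteq> x) u) = {}}. y I)"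
proof -
  define b where "b = set (takeWhile (\<lambda>z. z \<noteq> x) u)"
  have "vertex (coverage n y) u x = (\<Sum>I\<in>Pow {1..n} - {{}}. if x \<in> I \<and> I \<inter> b = {} then y I else 0)"
    unfolding vertex_def marginal_def coverage_altdef b_def[symmetric] sum_subtractf[symmetric]
    by (intro sum.cong refl) auto
  also have "\<dots> = (\<Sum>I\<in>{I\<in>Pow {1..n} - {{}}. x \<in> I \<and> I \<inter> b = {}}. y I)"
    by (rule sum.inter_filter[symmetric]) simp
  finally show ?thesis unfolding b_def .
qed

lemma first_in_iff:
  assumes "I \<inter> set u \<noteq> {}"
  shows "x \<in> I \<and> x \<in> set u \<and> I \<inter> set (takeWhile (\<lambda>z. z \<noteq> x) u) = {} \<longleftrightarrow> x = hd (filter (\<lambda>z. z \<in> I) u)"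
  using assms
proof (induction u)
  case (Cons a u)
  then show ?case
    by (cases "a \<in> I"; cases "x = a"; cases "I \<inter> set u = {}") auto
qed simp

text \<open>From each simplex choose the corner \<open>h I\<close>, the element of \<open>I\<close>
  that comes first in \<open>u\<close>. The weighted sum of these corners is the greedy
  vertex.\<close>

lemma point_vertex_coverage_mem:
  assumes u: "u \<in> permutations_of_set {1..n}"
  shows "point n (vertex (coverage n y) u) \<in> gen_permutohedron n y"
proof -
  let ?X = "Pow {1..n} - {{}}"
  define h where "h = (\<lambda>I. hd (filter (\<lambda>z. z \<in> I) u))"
  have su: "set u = {1..n}" using u by (auto dest: permutations_of_setD)
  have h: "x \<in> I \<and> I \<inter> set (takeWhile (\<lambda>z. z \<noteq> x) u) = {} \<longleftrightarrow> x = h I" if "I \<in> ?X" "x \<in> {1..n}" for I x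
    using first_in_iff[of I u x] that unfolding h_def su by blast
  have hI: "h I \<in> I" if "I \<in> ?X" for I
    using first_in_iff[of I u "h I"] that unfolding h_def su by blast
  have "point n (vertex (coverage n y) u) = (\<Sum>I\<in>?X. y I *\<^sub>R Poly_Mapping.single (h I) 1)"
  proof (rule poly_mapping_eqI)
    fix x
    have "Poly_Mapping.lookup (\<Sum>I\<in>?X. y I *\<^sub>R Poly_Mapping.single (h I) 1) x = (\<Sum>I\<in>?X. if x = h I then y I else 0)"
      unfolding lookup_sum_pm lookup_scaleR lookup_single when_def by (intro sum.cong refl) simp
    also have "\<dots> = Poly_Mapping.lookup (point n (vertex (coverage n y) u)) x"
    proof (cases "x \<in> {1..n}")
      case True
      have "(\<Sum>I\<in>?X. if x = h I then y I else 0) = (\<Sum>I\<in>?X. if x \<in> I \<and> I \<inter> set (takeWhile (\<lambda>z. z \<noteq> x) u) = {} then y I else 0)"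
        using h True by (intro sum.cong refl if_cong) auto
      also have "\<dots> = vertex (coverage n y) u x"
        unfolding vertex_coverage by (rule sum.inter_filter[symmetric]) simp
      finally show ?thesis using True by (simp add: lookup_point)
    next
      case False
      have "x \<noteq> h I" if "I \<in> ?X" for I
        using hI[OF that] that False by blast
      then have "(\<Sum>I\<in>?X. if x = h I then y I else 0) = 0"
        by (intro sum.neutral) simp
      moreover have "Poly_Mapping.lookup (point n (vertex (coverage n y) u)) x = 0"
        using False by (simp only: lookup_point if_False)
      ultimately show ?thesis by simp
    qed
    finally show "Poly_Mapping.lookup (point n (vertex (coverage n y) u)) x = Poly_Mapping.lookup (\<Sum>I\<in>?X. y I *\<^sub>R Poly_Mapping.single (h I) 1) x"
      by simp
  qed
  moreover have "\<forall>I\<in>?X. y I *\<^sub>R Poly_Mapping.single (h I) 1 \<in> (\<lambda>x. y I *\<^sub>R x) ` coord_simplex I"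
    unfolding coord_simplex_def using hI by (intro ballI imageI hull_inc) auto
  ultimately show ?thesis
    unfolding gen_permutohedron_def by (subst set_sum_alt) auto
qed

lemma convex_gen_permutohedron: "convex (gen_permutohedron n y)"
  unfolding gen_permutohedron_def coord_simplex_def
  by (intro convex_set_sum convex_scaling convex_convex_hull)

text \<open>No decomposition of a general point is constructed: it suffices to place the greedy
  vertices in the Minkowski sum and to use its convexity.\<close>

lemma base_polytope_subset_gen_permutohedron:
  assumes "n \<ge> 1" "\<And>I. I \<subseteq> {1..n} \<Longrightarrow> I \<noteq> {} \<Longrightarrow> y I \<ge> 0" "t \<in> base_polytope n (coverage n y)"
  shows "point n t \<in> gen_permutohedron n y"
proof -
  have "convex hull ((\<lambda>u. point n (vertex (coverage n y) u)) ` permutations_of_set {1..n}) \<subseteq> gen_permutohedron n y"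
    using point_vertex_coverage_mem convex_gen_permutohedron by (intro hull_minimal) blast+
  then show ?thesis
    using base_polytope_subset_hull[OF assms(1) submodular_coverage assms(3)] assms(2) by blast
qed

text \<open>Summing over \<open>S\<close> is a linear functional with values 0 or 1 at the corners,
  and the preimage of a convex set of reals is convex. The three claims use the sets
  \<open>{..1}\<close>, \<open>{0}\<close> and \<open>{1}\<close>.\<close>

lemma coord_simplexD:
  assumes x: "x \<in> coord_simplex I" and S: "finite S"
  shows "(\<Sum>i\<in>S. Poly_Mapping.lookup x i) \<le> 1"
    and "S \<inter> I = {} \<Longrightarrow> (\<Sum>i\<in>S. Poly_Mapping.lookup x i) = 0"
    and "I \<subseteq> S \<Longrightarrow> (\<Sum>i\<in>S. Poly_Mapping.lookup x i) = 1"
proof -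
  define l where "l = (\<lambda>x :: (nat, real) poly_mapping. \<Sum>i\<in>S. Poly_Mapping.lookup x i)"
  have lin: "l (a *\<^sub>R x + b *\<^sub>R z) = a * l x + b * l z" for a b x z
    by (simp add: l_def lookup_add lookup_scaleR sum.distrib sum_distrib_left)
  have l1: "l (Poly_Mapping.single i 1) = (if i \<in> S then 1 else 0)" for i
    using S by (simp add: l_def lookup_single when_def)
  have *: "l x \<in> C" if "convex C" "\<And>i. i \<in> I \<Longrightarrow> (if i \<in> S then 1 else 0) \<in> C" for C
  proof -
    have "coord_simplex I \<subseteq> l -` C"
      unfolding coord_simplex_def
    proof (rule hull_minimal)
      show "(\<lambda>i. Poly_Mapping.single i 1) ` I \<subseteq> l -` C" using that(2) by (auto simp: l1)
      show "convex (l -` C)"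
        using convexD[OF that(1)] by (auto intro!: convexI simp: lin)
    qed
    then show ?thesis using x by auto
  qed
  show "(\<Sum>i\<in>S. Poly_Mapping.lookup x i) \<le> 1"
    using *[of "{..1}"] by (auto simp: l_def)
  show "(\<Sum>i\<in>S. Poly_Mapping.lookup x i) = 0" if "S \<inter> I = {}"
  proof -
    have "l x \<in> {0}" by (rule *) (use that in auto)
    then show ?thesis by (simp add: l_def)
  qed
  show "(\<Sum>i\<in>S. Poly_Mapping.lookup x i) = 1" if "I \<subseteq> S"
  proof -
    have "l x \<in> {1}" by (rule *) (use that in auto)
    then show ?thesis by (simp add: l_def)
  qed
qed

lemma gen_permutohedron_subset_base_polytope:
  assumes y: "\<And>I. I \<subseteq> {1..n} \<Longrightarrow> I \<noteq> {} \<Longrightarrow> y I \<ge> 0" and t: "t \<in> gen_permutohedron n y"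
  shows "Poly_Mapping.lookup t \<in> base_polytope n (coverage n y)"
proof -
  let ?X = "Pow {1..n} - {{}}"
  have "\<exists>s. t = sum s ?X \<and> (\<forall>I\<in>?X. s I \<in> (\<lambda>x. y I *\<^sub>R x) ` coord_simplex I)"
    using t unfolding gen_permutohedron_def by (subst (asm) set_sum_alt) auto
  then obtain s where s: "t = sum s ?X" "\<forall>I\<in>?X. s I \<in> (\<lambda>x. y I *\<^sub>R x) ` coord_simplex I" by blast
  then have "\<forall>I\<in>?X. \<exists>x. x \<in> coord_simplex I \<and> s I = y I *\<^sub>R x" by blast
  then obtain x where x: "\<And>I. I \<in> ?X \<Longrightarrow> x I \<in> coord_simplex I" "\<And>I. I \<in> ?X \<Longrightarrow> s I = y I *\<^sub>R x I"
    by metis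
  have sum: "sum (Poly_Mapping.lookup t) S = (\<Sum>I\<in>?X. y I * (\<Sum>i\<in>S. Poly_Mapping.lookup (x I) i))" for S
  proof -
    have "t = (\<Sum>I\<in>?X. y I *\<^sub>R x I)" unfolding s(1) using x(2) by (intro sum.cong) auto
    then show ?thesis
      by (simp add: lookup_sum_pm lookup_scaleR sum.swap[of _ S] sum_distrib_left)
  qed
  show ?thesis
    unfolding base_polytope_def
  proof (intro CollectI conjI allI impI)
    show "sum (Poly_Mapping.lookup t) {1..n} = coverage n y {1..n}"
      unfolding sum coverage_altdef
    proof (intro sum.cong refl)
      fix I assume I: "I \<in> ?X"
      then have "I \<subseteq> {1..n}" "I \<inter> {1..n} \<noteq> {}" by auto
      then show "y I * (\<Sum>i\<in>{1..n}. Poly_Mapping.lookup (x I) i) = (if I \<inter> {1..n} \<noteq> {} then y I else 0)"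
        using coord_simplexD(3)[OF x(1)[OF I], of "{1..n}"] by simp
    qed
    fix S :: "nat set" assume "S \<subseteq> {1..n}"
    then have S: "finite S" using finite_subset by blast
    show "sum (Poly_Mapping.lookup t) S \<le> coverage n y S"
      unfolding sum coverage_altdef
    proof (rule sum_mono)
      fix I assume I: "I \<in> ?X"
      then have "y I \<ge> 0" using y by auto
      then show "y I * (\<Sum>i\<in>S. Poly_Mapping.lookup (x I) i) \<le> (if I \<inter> S \<noteq> {} then y I else 0)"
        using coord_simplexD(1,2)[OF x(1)[OF I] S] by (auto simp: Int_commute mult_left_le)
    qed
  qed
qed

lemma Vol_gen_permutohedron:
  assumes n: "n \<ge> 1" and y: "\<And>I. I \<subseteq> {1..n} \<Longrightarrow> I \<noteq> {} \<Longrightarrow> y I \<ge> 0"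
  shows "Vol n (gen_permutohedron n y) = vertex_sum n (coverage n y)"
proof -
  let ?f = "coverage n y"
  have N: "{1..n} - {n} = {1..<n}" "{1..n} = insert n {1..<n}" using n by auto
  have "(\<lambda>t. restrict (Poly_Mapping.lookup t) {1..<n}) ` gen_permutohedron n y = region n ?f n"
  proof (intro equalityI subsetI)
    fix x assume "x \<in> (\<lambda>t. restrict (Poly_Mapping.lookup t) {1..<n}) ` gen_permutohedron n y"
    then obtain t where t: "t \<in> gen_permutohedron n y" and x: "x = restrict (Poly_Mapping.lookup t) {1..<n}" by blast
    have B: "Poly_Mapping.lookup t \<in> base_polytope n ?f"
      by (rule gen_permutohedron_subset_base_polytope[OF y t])
    have "sum (Poly_Mapping.lookup t) (insert n {1..<n}) = ?f {1..n}"
      using B unfolding base_polytope_def N(2)[symmetric] by simp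
    then have "(x(n := ?f {1..n} - sum x {1..<n})) i = Poly_Mapping.lookup t i" if "i \<in> {1..n}" for i
      using that by (auto simp: x)
    then have "x(n := ?f {1..n} - sum x {1..<n}) \<in> base_polytope n ?f \<longleftrightarrow> Poly_Mapping.lookup t \<in> base_polytope n ?f"
      by (intro base_polytope_cong[of n "x(n := ?f {1..n} - sum x {1..<n})" "Poly_Mapping.lookup t"]) blast
    with B have "x(n := ?f {1..n} - sum x {1..<n}) \<in> base_polytope n ?f" by blast
    then show "x \<in> region n ?f n"
      unfolding region_def N(1) by (simp add: space_PiM x)
  next
    fix x assume x: "x \<in> region n ?f n"
    define t where "t = x(n := ?f {1..n} - sum x {1..<n})"
    have "t \<in> base_polytope n ?f" using x unfolding region_def N(1) t_def by simp
    then have "point n t \<in> gen_permutohedron n y"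
      using n y by (intro base_polytope_subset_gen_permutohedron) auto
    moreover have "x = restrict (Poly_Mapping.lookup (point n t)) {1..<n}"
    proof
      fix i
      have "x \<in> extensional {1..<n}" using x unfolding region_def N(1) by (simp add: space_PiM PiE_def)
      then show "x i = restrict (Poly_Mapping.lookup (point n t)) {1..<n} i"
        by (cases "i \<in> {1..<n}") (auto simp: lookup_point t_def extensional_def)
    qed
    ultimately show "x \<in> (\<lambda>t. restrict (Poly_Mapping.lookup t) {1..<n}) ` gen_permutohedron n y" by blast
  qed
  then have "Vol n (gen_permutohedron n y) = measure (Pi\<^sub>M ({1..n} - {n}) (\<lambda>_. lborel)) (region n ?f n)"
    unfolding Vol_def N(1) by simp
  also have "\<dots> = vertex_sum n ?f"
    using emeasure_region[OF n submodular_coverage] emeasure_region_swap[of n n 1 ?f] n y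
    by (simp add: measure_def)
  finally show ?thesis .
qed

section \<open>Sign sequences, prefix sums and the passage from orderings to permutations\<close>

lemma sum_list_pm1: "set xs \<subseteq> {1, -1} \<Longrightarrow> sum_list xs = int (length xs) - 2 * int (count_list xs (-1))"
  by (induction xs) auto

lemma count_list_take_le: "count_list (take k xs) a \<le> count_list xs a"
  by (metis append_take_drop_id count_list_append le_add1)

text \<open>The \<open>i\<close>-th entry -1 stands at position \<open>i\<close> plus the sum of the
  first \<open>i\<close> values of \<open>c\<close>. A prefix of length \<open>2 * i - 1\<close> has
  negative sum exactly if it contains at least \<open>i\<close> entries -1, that is, if it reaches
  that position.\<close>

lemma neg_prefix_set_eq:
  assumes c: "(\<Sum>k<n. c (Suc k)) = n - 1"
  shows "neg_prefix_set n c = {i\<in>{1..<n}. (\<Sum>k<i. c (Suc k)) < i}"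
proof -
  define L where "L = (\<lambda>i. concat (map (\<lambda>j. replicate (c j) 1 @ [-1]) [1..<i+1]) :: int list)"
  have L_Suc: "L (Suc i) = L i @ replicate (c (Suc i)) 1 @ [-1]" for i
    by (simp add: L_def)
  have len: "length (L i) = (\<Sum>k<i. c (Suc k)) + i" for i
    by (induction i) (simp_all add: L_Suc, simp add: L_def)
  have cnt: "count_list (L i) (-1) = i" for i
    by (induction i) (simp_all add: L_Suc count_list_0_iff, simp add: L_def)
  have set: "set (L i) \<subseteq> {1, -1}" for i
    by (auto simp: L_def)
  have "sum_list (take (2 * i - 1) (eps_seq n c)) < 0 \<longleftrightarrow> (\<Sum>k<i. c (Suc k)) < i" if i: "i \<in> {1..<n}" for i
  proof -
    define E where "E = take (2 * i - 1) (L n)"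
    \<comment> \<open>Since \<open>i < n\<close>, the prefix ends before the last -1, so its removal
      by \<open>butlast\<close> has no effect here.\<close>
    have "length (L n) = 2 * n - 1" using c i by (simp add: len)
    moreover have "eps_seq n c = butlast (L n)" by (simp add: eps_seq_def L_def)
    ultimately have E: "take (2 * i - 1) (eps_seq n c) = E" and lenE: "length E = 2 * i - 1"
      using i unfolding E_def by (auto simp: butlast_conv_take min_absorb1)
    have "set E \<subseteq> {1, -1}" using set[of n] unfolding E_def by (auto dest!: in_set_takeD)
    then have sumE: "sum_list E = 2 * int i - 1 - 2 * int (count_list E (-1))"
      using i by (simp add: sum_list_pm1 lenE)
    have "[1..<n+1] = [1..<i+1] @ [i+1..<n+1]" using i upt_add_eq_append[of 1 "i+1" "n-i"] by simp
    then obtain R where R: "L n = L i @ R" unfolding L_def by simp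
    show ?thesis
    proof (cases "(\<Sum>k<i. c (Suc k)) < i")
      case True
      then have "E = L i @ take (2 * i - 1 - length (L i)) R"
        unfolding E_def R by (simp add: len)
      then have "count_list E (-1) \<ge> i" by (simp add: cnt)
      then show ?thesis using True sumE E by simp
    next
      case False
      obtain j where j: "i = Suc j" using i by (cases i) auto
      have "2 * i - 1 \<le> length (L j @ replicate (c i) 1)"
        using False len[of i] by (simp add: j L_Suc)
      then have "E = take (2 * i - 1) (L j @ replicate (c i) 1)"
        unfolding E_def R by (simp add: j L_Suc)
      then have "count_list E (-1) \<le> count_list (L j @ replicate (c i) 1) (-1)"
        using count_list_take_le by metis
      also have "\<dots> = j" by (simp add: cnt count_list_0_iff)
      finally show ?thesis using False sumE E by (simp add: j)
    qed
  qed
  then show ?thesis unfolding neg_prefix_set_def by blast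
qed

lemma collection_set_eq:
  assumes J: "J \<in> {1..<n} \<rightarrow>\<^sub>E (Pow {1..n} - {{}})"
  shows "collection_set n J = {i\<in>{1..<n}. (\<Sum>k<i. card {j\<in>{1..<n}. Min (J j) = Suc k}) < i}"
proof -
  define c where "c = Poly_Mapping.lookup (\<Sum>k\<in>{1..<n}. Poly_Mapping.single (Min (J k)) (1::nat))"
  have c: "c x = card {j\<in>{1..<n}. Min (J j) = x}" for x
    unfolding c_def lookup_sum_pm lookup_single when_def
    by (subst sum.inter_filter[symmetric]) auto
  have Min: "Min (J j) \<in> {1..n}" if "j \<in> {1..<n}" for j
  proof -
    have "J j \<subseteq> {1..n}" "J j \<noteq> {}" using PiE_mem[OF J that] by auto
    then have "Min (J j) \<in> J j" using finite_subset by (intro Min_in) auto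
    then show ?thesis using \<open>J j \<subseteq> {1..n}\<close> by blast
  qed
  have "(\<Sum>k<n. c (Suc k)) = (\<Sum>x\<in>{1..n}. c x)"
    by (rule sum.reindex_bij_witness[of _ "\<lambda>x. x - 1" Suc]) auto
  also have "\<dots> = card {1..<n}"
    unfolding c using sum.group[of "{1..<n}" "{1..n}" "\<lambda>j. Min (J j)" "\<lambda>_. 1::nat"] Min by fastforce
  finally have "(\<Sum>k<n. c (Suc k)) = n - 1" by simp
  from neg_prefix_set_eq[OF this] show ?thesis
    unfolding collection_set_def c_def[symmetric] c .
qed

lemma bij_betw_permutes_permutations_of_set:
  "bij_betw (\<lambda>w. map w [1..<n+1]) {w. w permutes {1..n}} (permutations_of_set {1..n})"
proof -
  let ?g = "\<lambda>w. map w [1..<n+1]"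
  have inj: "inj_on ?g {w. w permutes {1..n}}"
  proof (rule inj_onI)
    fix v w :: "nat \<Rightarrow> nat"
    assume "v \<in> {w. w permutes {1..n}}" "w \<in> {w. w permutes {1..n}}" and e: "?g v = ?g w"
    then have p: "v permutes {1..n}" "w permutes {1..n}" by auto
    have "v x = w x" for x
    proof (cases "x \<in> {1..n}")
      case True
      then have "x \<in> set [1..<n+1]" by auto
      then show ?thesis using e unfolding map_eq_conv by blast
    next
      case False
      then show ?thesis using p by (simp add: permutes_not_in)
    qed
    then show "v = w" ..
  qed
  have sub: "?g ` {w. w permutes {1..n}} \<subseteq> permutations_of_set {1..n}"
  proof clarify
    fix w assume w: "w permutes {1..n}"
    have "set [1..<n+1] = {1..n}" by auto
    then show "?g w \<in> permutations_of_set {1..n}"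
      using permutes_image[OF w] permutes_inj_on[OF w] unfolding permutations_of_set_def by (simp add: distinct_map)
  qed
  have "card (?g ` {w. w permutes {1..n}}) = card (permutations_of_set {1..n})"
    unfolding card_image[OF inj] by (simp add: card_permutations)
  then have "?g ` {w. w permutes {1..n}} = permutations_of_set {1..n}"
    using card_subset_eq[OF _ sub] by simp
  then show ?thesis using inj by (simp add: bij_betw_def)
qed

text \<open>The exponent at \<open>w x\<close> is the number of sets with minimum \<open>x\<close>.
  Reading it along \<open>w\<close> undoes the relabelling, so the prefix sums are those defining
  \<open>collection_set\<close>, whatever \<open>w\<close> is; only the descents depend on
  \<open>w\<close>.\<close>

lemma desc_sign_collection:
  assumes w: "w permutes {1..n}" and J: "J \<in> {1..<n} \<rightarrow>\<^sub>E (Pow {1..n} - {{}})"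
  shows "desc_sign (\<lambda>x. int (value_count {1..<n} (\<lambda>k. w (Min (J k))) x)) 0 (map w [1..<n+1]) =
    (if descent_set n w = collection_set n J then (-1) ^ card (collection_set n J) else 0)"
proof -
  let ?u = "map w [1..<n+1]"
  let ?a = "\<lambda>x. int (value_count {1..<n} (\<lambda>k. w (Min (J k))) x)"
  have u: "?u ! k = w (Suc k)" if "k < n" for k using that by (simp add: nth_upt del: upt_Suc)
  have a: "?a (w x) = int (card {j\<in>{1..<n}. Min (J j) = x})" for x
    unfolding value_count_def using permutes_inj[OF w] by (simp add: inj_eq)
  have "desc_sign ?a 0 ?u = (\<Prod>i\<in>{1..<n}. sgn_factor (int (\<Sum>k<i. card {j\<in>{1..<n}. Min (J j) = Suc k}) - int i) (w i > w (i + 1)))"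
    unfolding desc_sign_prod
  proof (intro prod.cong)
    fix i assume i: "i \<in> {1..<n}"
    have "(\<Sum>k<i. ?a (?u ! k)) = int (\<Sum>k<i. card {j\<in>{1..<n}. Min (J j) = Suc k})"
      unfolding of_nat_sum
    proof (intro sum.cong refl)
      fix k assume "k \<in> {..<i}"
      then have "k < n" using i by simp
      then show "?a (?u ! k) = int (card {j\<in>{1..<n}. Min (J j) = Suc k})" by (simp only: u a)
    qed
    moreover have "?u ! (i - 1) = w i" "?u ! i = w (i + 1)" using i u[of "i - 1"] u[of i] by auto
    ultimately show "sgn_factor (0 + (\<Sum>k<i. ?a (?u ! k)) - int i) (?u ! (i - 1) > ?u ! i) =
        sgn_factor (int (\<Sum>k<i. card {j\<in>{1..<n}. Min (J j) = Suc k}) - int i) (w i > w (i + 1))"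
      by simp
  qed simp
  also have "\<dots> = (if descent_set n w = collection_set n J then (-1) ^ card (collection_set n J) else 0)"
  proof (subst prod_sgn_factor)
    have "{i \<in> {1..<n}. int (\<Sum>k<i. card {j \<in> {1..<n}. Min (J j) = Suc k}) - int i < 0} = collection_set n J"
      unfolding collection_set_eq[OF J] by (intro Collect_cong conj_cong refl) linarith
    moreover have "{i \<in> {1..<n}. w i > w (i + 1)} = descent_set n w" by (simp add: descent_set_def)
    ultimately show "(if {i \<in> {1..<n}. int (\<Sum>k<i. card {j \<in> {1..<n}. Min (J j) = Suc k}) - int i < 0} = {i \<in> {1..<n}. w i > w (i + 1)}
        then (-1) ^ card {i \<in> {1..<n}. int (\<Sum>k<i. card {j \<in> {1..<n}. Min (J j) = Suc k}) - int i < 0} else 0) =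
      (if descent_set n w = collection_set n J then (-1) ^ card (collection_set n J) else (0::real))"
      by (simp only: eq_commute)
  qed simp
  finally show ?thesis .
qed

text \<open>Substitute \<open>I = w\<close>
  J\<open>: in the ordering w(1), ..., w(n) the first element of\<close>w \<open>J\<close> is
  \<open>w (Min J)\<close>, so the sets first hit at \<open>x\<close> are those with
  \<open>w (Min J) = x\<close>.\<close>

lemma vertex_coverage_permutes:
  assumes w: "w permutes {1..n}" and x: "x \<in> {1..n}"
  shows "vertex (coverage n y) (map w [1..<n+1]) x = (\<Sum>J\<in>{J\<in>Pow {1..n} - {{}}. w (Min J) = x}. y (w ` J))"
proof -
  obtain i where i: "i \<in> {1..n}" "x = w i" using permutes_image[OF w] x by blast
  note inj = permutes_inj[OF w]
  have "[1..<n+1] = [1..<i] @ i # [i+1..<n+1]"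
    using i upt_add_eq_append[of 1 i "n + 1 - i"] upt_conv_Cons[of i "n + 1"] by simp
  then have "map w [1..<n+1] = map w [1..<i] @ x # map w [i+1..<n+1]"
    unfolding i(2) by (simp only: map_append list.map)
  moreover have "x \<notin> set (map w [1..<i])" using inj by (auto simp: i(2) inj_eq)
  ultimately have "takeWhile (\<lambda>z. z \<noteq> x) (map w [1..<n+1]) = map w [1..<i]"
    using takeWhile_neq_mid(1) by metis
  then have b: "set (takeWhile (\<lambda>z. z \<noteq> x) (map w [1..<n+1])) = w ` {1..<i}" by simp
  have Min: "Min J = i \<longleftrightarrow> i \<in> J \<and> J \<inter> {1..<i} = {}" if "J \<in> Pow {1..n} - {{}}" for J
  proof -
    have J: "finite J" "J \<noteq> {}" "J \<subseteq> {1..n}" using that finite_subset by auto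
    show ?thesis
    proof
      assume "Min J = i"
      then show "i \<in> J \<and> J \<inter> {1..<i} = {}" using Min_in[OF J(1,2)] Min_le[OF J(1)] by force
    next
      assume "i \<in> J \<and> J \<inter> {1..<i} = {}"
      then show "Min J = i"
        using J by (intro Min_eqI) (auto intro!: leI dest: subsetD simp: disjoint_iff)
    qed
  qed
  have im: "w ` J \<subseteq> {1..n} \<longleftrightarrow> J \<subseteq> {1..n}" for J
    using inj_image_subset_iff[OF inj, of J "{1..n}"] permutes_image[OF w] by simp
  have sj: "w ` inv w ` I = I" for I using permutes_surj[OF w] by (simp add: image_f_inv_f)
  have ij: "inv w ` w ` J = J" for J using inj by (simp add: image_inv_f_f)
  show ?thesis
    unfolding vertex_coverage b
  proof (rule sum.reindex_bij_witness[of _ "\<lambda>J. w ` J" "\<lambda>I. inv w ` I"])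
    have key: "J \<in> Pow {1..n} - {{}} \<and> w (Min J) = x \<longleftrightarrow> w ` J \<in> Pow {1..n} - {{}} \<and> x \<in> w ` J \<and> w ` J \<inter> w ` {1..<i} = {}" for J
    proof -
      have "w ` J \<inter> w ` {1..<i} = {} \<longleftrightarrow> J \<inter> {1..<i} = {}" using inj by (simp add: image_Int[symmetric])
      moreover have "x \<in> w ` J \<longleftrightarrow> i \<in> J" unfolding i using inj by (simp add: inj_image_mem_iff)
      moreover have "w (Min J) = x \<longleftrightarrow> Min J = i" unfolding i using inj by (simp add: inj_eq)
      ultimately show ?thesis using Min[of J] im[of J] by auto
    qed
    show "inv w ` I \<in> {J \<in> Pow {1..n} - {{}}. w (Min J) = x}"
      if "I \<in> {I \<in> Pow {1..n} - {{}}. x \<in> I \<and> I \<inter> w ` {1..<i} = {}}" for I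
      using key[of "inv w ` I"] that unfolding sj by blast
    show "w ` J \<in> {I \<in> Pow {1..n} - {{}}. x \<in> I \<and> I \<inter> w ` {1..<i} = {}}"
      if "J \<in> {J \<in> Pow {1..n} - {{}}. w (Min J) = x}" for J
      using key[of J] that by blast
  qed (simp_all only: sj ij)
qed

theorem theorem10p2:
  fixes n :: nat and y :: "nat set \<Rightarrow> real"
  assumes "n \<ge> 1"
    and "\<And>I. I \<subseteq> {1..n} \<Longrightarrow> I \<noteq> {} \<Longrightarrow> y I \<ge> 0"
  shows "Vol n (gen_permutohedron n y) =
    1 / fact (n - 1) *
      (\<Sum>J\<in>{1..<n} \<rightarrow>\<^sub>E (Pow {1..n} - {{}}).
        (-1) ^ card (collection_set n J) *
        (\<Sum>w | w permutes {1..n} \<and> descent_set n w = collection_set n J.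
          \<Prod>k\<in>{1..<n}. y (w ` J k)))"
proof -
  let ?X = "Pow {1..n} - {{}}" and ?f = "coverage n y" and ?W = "{w. w permutes {1..n}}"
  let ?J = "{1..<n} \<rightarrow>\<^sub>E ?X"
  define P where "P = (\<lambda>w J. \<Prod>k\<in>{1..<n}. y (w ` (J k :: nat set)))"
  define u where "u = (\<lambda>w :: nat \<Rightarrow> nat. map w [1..<n+1])"
  define K where "K = (\<lambda>a u. desc_sign (\<lambda>x. int (a x)) 0 u)"
  have W: "finite ?W" by (rule finite_permutations) simp
  \<comment> \<open>The sign and the descent condition merge into the weight \<open>K\<close>, so
    the inner sum can run over all permutations and be moved outside.\<close>
  have "(\<Sum>J\<in>?J. (-1) ^ card (collection_set n J) * (\<Sum>w | w permutes {1..n} \<and> descent_set n w = collection_set n J. P w J))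
      = (\<Sum>J\<in>?J. \<Sum>w\<in>?W. K (value_count {1..<n} (\<lambda>k. w (Min (J k)))) (u w) * P w J)"
  proof (intro sum.cong refl)
    fix J assume J: "J \<in> ?J"
    have "(\<Sum>w\<in>?W. K (value_count {1..<n} (\<lambda>k. w (Min (J k)))) (u w) * P w J) =
        (\<Sum>w\<in>?W. if descent_set n w = collection_set n J then (-1) ^ card (collection_set n J) * P w J else 0)"
      unfolding K_def u_def using desc_sign_collection[OF _ J] by (intro sum.cong refl) simp
    also have "\<dots> = (\<Sum>w\<in>{w\<in>?W. descent_set n w = collection_set n J}. (-1) ^ card (collection_set n J) * P w J)"
      by (rule sum.inter_filter[OF W, symmetric])
    finally show "(-1) ^ card (collection_set n J) * (\<Sum>w | w permutes {1..n} \<and> descent_set n w = collection_set n J. P w J) =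
        (\<Sum>w\<in>?W. K (value_count {1..<n} (\<lambda>k. w (Min (J k)))) (u w) * P w J)"
      by (simp add: sum_distrib_left)
  qed
  also have "\<dots> = (\<Sum>w\<in>?W. \<Sum>J\<in>?J. K (value_count {1..<n} (\<lambda>k. w (Min (J k)))) (u w) * P w J)"
    by (rule sum.swap)
  also have "\<dots> = (\<Sum>w\<in>?W. fact (n - 1) * (\<Sum>a\<in>comps {1..n} (n - 1). K a (u w) * dpow {1..n} (vertex ?f (u w)) a))"
  proof (intro sum.cong refl)
    fix w assume "w \<in> ?W"
    then have w: "w permutes {1..n}" by simp
    have "(\<lambda>I. w (Min I)) ` ?X \<subseteq> {1..n}"
    proof (rule image_subsetI)
      fix I assume "I \<in> ?X"
      then have I: "I \<subseteq> {1..n}" "I \<noteq> {}" by auto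
      then have "Min I \<in> I" using finite_subset by (intro Min_in) auto
      then have "Min I \<in> {1..n}" using I by blast
      then show "w (Min I) \<in> {1..n}" using permutes_in_image[OF w] by blast
    qed
    \<comment> \<open>For fixed \<open>w\<close> the weight depends on the collection only through
      how often each \<open>w (Min (J k))\<close> occurs, so the multinomial expansion
      applies.\<close>
    then have "(\<Sum>J\<in>?J. K (value_count {1..<n} (\<lambda>k. w (Min (J k)))) (u w) * P w J) =
       fact (card {1..<n}) * (\<Sum>a\<in>comps {1..n} (card {1..<n}). K a (u w) * dpow {1..n} (\<lambda>x. \<Sum>I\<in>{I\<in>?X. w (Min I) = x}. y (w ` I)) a)"
      unfolding P_def
      using sum_PiE_value_count[of "{1..<n}" ?X "{1..n}" "\<lambda>I. w (Min I)" "\<lambda>a. K a (u w)" "\<lambda>I. y (w ` I)"] by simp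
    moreover have "dpow {1..n} (\<lambda>x. \<Sum>I\<in>{I\<in>?X. w (Min I) = x}. y (w ` I)) a = dpow {1..n} (vertex ?f (u w)) a" for a
      unfolding u_def by (intro dpow_cong refl vertex_coverage_permutes[OF w, symmetric])
    ultimately show "(\<Sum>J\<in>?J. K (value_count {1..<n} (\<lambda>k. w (Min (J k)))) (u w) * P w J) =
       fact (n - 1) * (\<Sum>a\<in>comps {1..n} (n - 1). K a (u w) * dpow {1..n} (vertex ?f (u w)) a)"
      by simp
  qed
  also have "\<dots> = fact (n - 1) * (\<Sum>w\<in>?W. (\<lambda>v. \<Sum>a\<in>comps {1..n} (n - 1). K a v * dpow {1..n} (vertex ?f v) a) (u w))"
    by (simp add: sum_distrib_left)
  also have "\<dots> = fact (n - 1) * vertex_sum n ?f"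
    unfolding vertex_sum_def K_def u_def
    by (subst sum.reindex_bij_betw[OF bij_betw_permutes_permutations_of_set]) simp
  finally show ?thesis
    using Vol_gen_permutohedron[OF assms] unfolding P_def by simp
qed

end
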